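(* Let $G$ be a strongly balanced connected graph with $v(G)\ge2$ vertices and $e(G)$ edges, and let $N_G$ be the number of copies of $G$ in the binomial random-connection model $G_H(\mathcal{X}_n)$ with connection probabilities $p_nH(X_i,X_j)$. a) If $n^{-(v(G)-1)/e(G)}\ll p_n$, then for $n$ large enough we have $$|\kappa_j(N_G)|\le j^{j-1}(j!)^{v(G)}\frac{(v(G)!)^{j-1}}{a(G)^j}\,n^{1+(v(G)-1)j}\,p_n^{j\,e(G)},\qquad j\ge 2.$$ b) If $p_n\ll n^{-(v(G)-1)/e(G)}$, then for $n$ large enough we have $$|\kappa_j(N_G)|\le j^{j-1}(j!)^{v(G)}\frac{(v(G)!)^{j-1}}{a(G)^j}\,n^{v(G)}\,p_n^{e(G)},\qquad j\ge 2.$$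
   Context: Binomial random-connection model. $X_1,\dots,X_n$ are i.i.d. random points of $\mathbb{R}^d$ with common continuous (atomless) distribution $\mu$, $\mathcal{X}_n=\{X_1,\dots,X_n\}$, $H:\mathbb{R}^d\times\mathbb{R}^d\to[0,1]$ is a symmetric measurable function, and $p_n\in(0,1)$ for each $n$; $\mu$ and $H$ do not depend on $n$. Given $\mathcal{X}_n$, each pair $X_i,X_j$ ($i\ne j$) is connected by an edge (written $X_i\sim X_j$) independently with probability $p_nH(X_i,X_j)$. The resulting random graph is $G_H(\mathcal{X}_n)$. Subgraph count. $G=(V_G,E_G)$ is a simple graph with $v(G)=|V_G|=k$, vertex set identified with $[k]=\{1,\dots,k\}$, $e(G)=|E_G|$, and $a(G)$ is the number of automorphisms of $G$. With $[n]^k_{\neq}:=\{\beta\in[n]^k:\beta(i)\ne\beta(j)\text{ for }i\ne j\}$, $$N_G:=\frac{1}{a(G)}\sum_{\beta\in[n]^k_{\neq}}\ \prod_{\{u,v\}\in E_G}\mathbf{1}_{\{X_{\beta(u)}\sim X_{\beta(v)}\}}.$$ $G$ is strongly balanced if $\dfrac{e(G')}{v(G')-1}\le\dfrac{e(G)}{v(G)-1}$ for every subgraph $G'\subset G$ with $v(G')\ge2$. $f(n)\ll g(n)$ means $f(n)\ge0$, $g(n)>0$ and $\lim_{n\to\infty}f(n)/g(n)=0$. $\kappa_j$ denotes the $j$-th cumulant. *)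

theory Defs
  imports "HOL-Probability.Probability" "HOL-Combinatorics.Permutations"
begin

section \<open>Finite simple graphs\<close>

text \<open>A graph is given by its vertex set and its set of edges, each edge being an unordered
  pair, i.e. a two-element set of vertices.\<close>

definition simple_graph :: "nat set \<Rightarrow> nat set set \<Rightarrow> bool" where
  "simple_graph V E \<longleftrightarrow> finite V \<and> (\<forall>e\<in>E. e \<subseteq> V \<and> card e = 2)"

definition subgraph :: "nat set \<Rightarrow> nat set set \<Rightarrow> nat set \<Rightarrow> nat set set \<Rightarrow> bool" where
  "subgraph V' E' V E \<longleftrightarrow> simple_graph V' E' \<and> V' \<subseteq> V \<and> E' \<subseteq> E"

definition connected_graph :: "nat set \<Rightarrow> nat set set \<Rightarrow> bool" where
  "connected_graph V E \<longleftrightarrow> V \<noteq> {} \<and> (\<forall>u\<in>V. \<forall>v\<in>V. (u, v) \<in> {(x, y). {x, y} \<in> E}\<^sup>*)"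

definition automorphisms :: "nat set \<Rightarrow> nat set set \<Rightarrow> (nat \<Rightarrow> nat) set" where
  "automorphisms V E =
     {\<sigma>. \<sigma> permutes V \<and> (\<forall>u\<in>V. \<forall>v\<in>V. {\<sigma> u, \<sigma> v} \<in> E \<longleftrightarrow> {u, v} \<in> E)}"

definition strongly_balanced :: "nat set \<Rightarrow> nat set set \<Rightarrow> bool" where
  "strongly_balanced V E \<longleftrightarrow>
     (\<forall>V' E'. subgraph V' E' V E \<and> 2 \<le> card V' \<longrightarrow>
        real (card E') / (real (card V') - 1) \<le> real (card E) / (real (card V) - 1))"

section \<open>The binomial random-connection model\<close>

text \<open>The points are \<open>X 1, \<dots>, X n\<close>; since they are almost surely distinct, the random graph is
  represented on the index set \<open>{1..n}\<close>, with \<open>A \<omega>\<close> its set of edges: \<open>{i, j} \<in> A \<omega>\<close>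
  means that \<open>X i\<close> and \<open>X j\<close> are connected.

  The last assumption is the conditional independence of the edges given the points: for every
  set \<open>S\<close> of pairs, the conditional probability that all pairs in \<open>S\<close> are connected is the
  product of the individual connection probabilities. As \<open>S\<close> ranges over all subsets, including
  singletons, this is mutual conditional independence of the edge events and it determines
  their joint conditional law. Unordered pairs are enumerated by \<open>i < j\<close>, which is
  harmless because \<open>H\<close> is symmetric.\<close>

locale random_connection_model = prob_space M
  for M :: "'w measure" +
  fixes n :: nat
    and \<mu> :: "(real ^ 'd) measure"
    and H :: "real ^ 'd \<Rightarrow> real ^ 'd \<Rightarrow> real"
    and p :: real
    and X :: "nat \<Rightarrow> 'w \<Rightarrow> real ^ 'd"
    and A :: "'w \<Rightarrow> nat set set"
  assumes mu_prob: "prob_space \<mu>"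
    and mu_sets: "sets \<mu> = sets borel"
    and mu_atomless: "\<And>x. measure \<mu> {x} = 0"
    and H_measurable: "case_prod H \<in> borel_measurable (borel \<Otimes>\<^sub>M borel)"
    and H_range: "\<And>x y. 0 \<le> H x y \<and> H x y \<le> 1"
    and H_sym: "\<And>x y. H x y = H y x"
    and p_range: "0 < p" "p < 1"
    and points_indep: "indep_vars (\<lambda>_. borel) X {1..n}"
    and points_distr: "\<And>i. i \<in> {1..n} \<Longrightarrow> distr M borel (X i) = \<mu>"
    and edges_graph: "\<And>\<omega>. \<omega> \<in> space M \<Longrightarrow> simple_graph {1..n} (A \<omega>)"
    and edges_measurable:
      "\<And>i j. 1 \<le> i \<Longrightarrow> i < j \<Longrightarrow> j \<le> n \<Longrightarrow> {\<omega> \<in> space M. {i, j} \<in> A \<omega>} \<in> sets M"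
    and edges_cond_indep:
      "\<And>S. S \<subseteq> {(i, j). 1 \<le> i \<and> i < j \<and> j \<le> n} \<Longrightarrow>
        AE \<omega> in M.
          real_cond_exp M
            (vimage_algebra (space M) (\<lambda>\<omega>. \<lambda>i\<in>{1..n}. X i \<omega>) (Pi\<^sub>M {1..n} (\<lambda>_. borel)))
            (indicator {\<omega> \<in> space M. \<forall>(i, j)\<in>S. {i, j} \<in> A \<omega>}) \<omega>
          = (\<Prod>(i, j)\<in>S. p * H (X i \<omega>) (X j \<omega>))"

text \<open>Number of copies, in a graph on \<open>{1..n}\<close> with edge set \<open>A\<close>, of the graph with vertex set
  \<open>{1..k}\<close> and edge set \<open>E\<close>. An edge \<open>e = {u, v}\<close> has image
  \<open>\<beta> ` e = {\<beta> u, \<beta> v}\<close>.\<close>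

definition subgraph_count :: "nat \<Rightarrow> nat set set \<Rightarrow> nat \<Rightarrow> nat set set \<Rightarrow> real" where
  "subgraph_count k E n A =
     1 / real (card (automorphisms {1..k} E)) *
     (\<Sum>\<beta> \<in> {\<beta> \<in> {1..k} \<rightarrow>\<^sub>E {1..n}. inj_on \<beta> {1..k}}. \<Prod>e\<in>E. of_bool (\<beta> ` e \<in> A))"

section \<open>Cumulants and asymptotic comparison\<close>

text \<open>The \<open>j\<close>-th cumulant is the \<open>j\<close>-th derivative at 0 of the logarithm of the moment
  generating function. This is meaningful when the latter is finite near 0, in particular for
  bounded random variables such as subgraph counts.\<close>

definition cumulant :: "'w measure \<Rightarrow> nat \<Rightarrow> ('w \<Rightarrow> real) \<Rightarrow> real" where
  "cumulant M j Y = (deriv ^^ j) (\<lambda>t. ln (integral\<^sup>L M (\<lambda>\<omega>. exp (t * Y \<omega>)))) 0"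

text \<open>Sequences are indexed by \<open>n \<ge> 1\<close>; the value at 0 is irrelevant.\<close>

definition much_less :: "(nat \<Rightarrow> real) \<Rightarrow> (nat \<Rightarrow> real) \<Rightarrow> bool" (infix "\<lless>" 50) where
  "f \<lless> g \<longleftrightarrow> (\<forall>n\<ge>1. 0 \<le> f n \<and> 0 < g n) \<and> (\<lambda>n. f n / g n) \<longlonglongrightarrow> 0"

end

theory Submission
  imports Defs
begin

text \<open>By Good's formula the \<open>j\<close>-th cumulant of \<open>N\<^sub>G\<close> is, up to \<open>a(G)\<^sup>-\<^sup>j\<close>, the sum over \<open>j\<close>-tuples of copies
  \<open>\<beta>\<close> of \<open>1/j\<close> times a sum over the \<open>j\<^sup>j\<close> functions \<open>f\<close> from \<open>[j]\<close> to \<open>[j]\<close> of a root of unity times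
  \<open>\<Prod>\<^sub>r P(\<close>all copies in \<open>f\<^sup>-\<^sup>1(r)\<close> are present\<open>)\<close>. The inner sum vanishes if the tuple splits into two
  vertex-disjoint groups, and each product is at most \<open>p\<^sup>e\<close>, where \<open>e\<close> is the number of edges and \<open>v\<close>
  the number of vertices of the union of the copies. If the tuple does not split, strong balance
  gives \<open>e \<ge> e(G) (v - 1) / (v(G) - 1)\<close>, hence \<open>p\<^sup>e \<le> n \<cdot> n\<^sup>-\<^sup>v q\<^bsup>v - 1\<^esup>\<close> with
  \<open>q = n p powr (e(G) / (v(G) - 1))\<close>; here \<open>v(G) \<le> v \<le> 1 + (v(G) - 1) j\<close>, and \<open>q \<ge> 1\<close> or \<open>q \<le> 1\<close> in
  the two regimes. It remains to see that the sum of \<open>n\<^sup>-\<^sup>v\<close> over all tuples is at most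
  \<open>(j!)\<^bsup>v(G)\<^esup> (v(G)!)\<^bsup>j - 1\<^esup>\<close>; this holds even without connectivity, since the sum is essentially the
  expectation of \<open>(v(G)! (v(G) + R choose v(G)))\<^bsup>j - 1\<^esup>\<close> for a binomial variable \<open>R\<close> of mean at most 1.\<close>

section \<open>Cumulants and roots of unity\<close>

lemma has_fps_expansion_higher_deriv:
  "f has_fps_expansion F \<Longrightarrow> (deriv ^^ n) f has_fps_expansion (fps_deriv ^^ n) F"
  by (induction n) (auto intro: has_fps_expansion_deriv)

lemma higher_deriv_at_0_fps:
  assumes "f has_fps_expansion F"
  shows "(deriv ^^ n) f 0 = fact n * fps_nth F n"
proof -
  have "(deriv ^^ n) f 0 = fps_nth ((fps_deriv ^^ n) F) 0"
    using has_fps_expansion_higher_deriv[OF assms, of n]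
    by (auto simp: has_fps_expansion_def eval_fps_at_0 dest: eventually_nhds_x_imp_x)
  then show ?thesis
    by (simp add: fps_0th_higher_deriv)
qed

text \<open>Logarithmic derivatives add over a product. The relation is multiplied out, so that no
  factor has to be invertible.\<close>

lemma fps_deriv_prod_log:
  fixes F L :: "'a \<Rightarrow> 'b::field fps"
  assumes "\<And>r. r \<in> A \<Longrightarrow> fps_deriv (F r) = L r * F r"
  shows "fps_deriv (\<Prod>r\<in>A. F r) = (\<Sum>r\<in>A. L r) * (\<Prod>r\<in>A. F r)"
  using assms by (induction A rule: infinite_finite_induct) (auto simp: algebra_simps)

text \<open>If \<open>j\<close> does not divide \<open>i\<close>, this is a full geometric sum whose
  ratio is a \<open>j\<close>-th root of unity other than 1.\<close>

lemma sum_cis_powers: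
  fixes j i :: nat
  assumes "0 < j"
  shows "(\<Sum>r<j. cis (2 * pi / j) ^ (r * i)) = (if j dvd i then of_nat j else 0)"
proof (cases "j dvd i")
  case True
  then obtain q where q: "i = j * q" by auto
  have "cis (2 * pi / j) ^ j = 1"
    using assms by (simp add: Complex.DeMoivre)
  then have "cis (2 * pi / j) ^ (r * i) = 1" for r
    by (metis q mult.left_commute power_mult power_one)
  then show ?thesis using True by simp
next
  case False
  define z where "z = cis (2 * pi / j) ^ i"
  have zj: "z ^ j = 1"
  proof -
    have "cis (2 * pi / j) ^ j = 1"
      using assms by (simp add: Complex.DeMoivre)
    then show ?thesis
      unfolding z_def by (metis power_mult mult.commute power_one)
  qed
  have z1: "z \<noteq> 1"
  proof
    assume "z = 1"
    then have "cis (i * (2 * pi / j)) = 1" by (simp add: z_def Complex.DeMoivre)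
    then have "cos (i * (2 * pi / j)) = 1" by (simp add: complex_eq_iff)
    then obtain m :: int where "i * (2 * pi / j) = m * 2 * pi"
      using cos_one_2pi_int by auto
    then have "real i = m * real j" using assms by (simp add: field_simps)
    then have "int i = m * int j"
      by (metis of_int_eq_iff of_int_mult of_int_of_nat_eq)
    then show False using False by (metis dvd_triv_right of_nat_dvd_iff)
  qed
  have "(\<Sum>r<j. cis (2 * pi / j) ^ (r * i)) = (\<Sum>r<j. z ^ r)"
    by (simp add: z_def power_mult[symmetric] mult.commute)
  also have "\<dots> = 0" using zj z1 by (simp add: geometric_sum)
  finally show ?thesis using False by simp
qed

text \<open>Good's formula. If \<open>Y\<^sub>r\<close>, \<open>r < j\<close>, are independent copies of a variable with cumulants
  \<open>\<kappa>\<^sub>m\<close>, then \<open>\<Sum>r. \<zeta>\<^sup>r Y\<^sub>r\<close> has cumulants \<open>\<kappa>\<^sub>m (\<Sum>r. \<zeta>\<^bsup>rm\<^esup>)\<close>, which vanish for \<open>0 < m < j\<close>, so that its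
  \<open>j\<close>-th moment is its \<open>j\<close>-th cumulant \<open>j \<kappa>\<^sub>j\<close>. The copies are indexed by the functions \<open>b\<close>.\<close>

lemma good_cumulant_formula:
  fixes w N :: "'b \<Rightarrow> real" and G :: "'b set" and j :: nat
  defines "\<zeta> \<equiv> cis (2 * pi / j)"
  assumes "finite G" and w0: "\<And>B. B \<in> G \<Longrightarrow> 0 \<le> w B" and w1: "sum w G = 1" and j: "0 < j"
  shows "of_nat j * of_real ((deriv ^^ j) (\<lambda>t. ln (\<Sum>B\<in>G. w B * exp (t * N B))) 0) =
    (\<Sum>b \<in> {..<j} \<rightarrow>\<^sub>E G. of_real (\<Prod>r<j. w (b r)) * (\<Sum>r<j. \<zeta> ^ r * of_real (N (b r))) ^ j)"
proof -
  define g where "g = (\<lambda>t. \<Sum>B\<in>G. w B * exp (t * N B))"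
  define F where "F = (\<Sum>B\<in>G. fps_const (w B) * fps_exp (N B))"
  \<comment> \<open>\<open>K\<close> is the derivative of the cumulant generating series: its
    coefficient \<open>i\<close> is the cumulant of order \<open>i + 1\<close> divided by
    \<open>fact i\<close>.\<close>
  define K where "K = fps_deriv F / F"
  have F: "g has_fps_expansion F"
    unfolding g_def F_def
    by (auto intro!: fps_expansion_intros simp: mult.commute[of _ "N _"])
  have F0: "fps_nth F 0 = 1"
    by (simp add: F_def fps_sum_nth w1)
  have pos: "g t > 0" for t
  proof -
    obtain B where B: "B \<in> G" "w B \<noteq> 0" using w1 by (metis sum.neutral zero_neq_one)
    then have "0 < w B * exp (t * N B)" using w0[of B] by simp
    also have "\<dots> \<le> g t"
      unfolding g_def using assms(2) B w0 by (intro member_le_sum) auto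
    finally show ?thesis .
  qed
  have dg: "(g has_field_derivative deriv g t) (at t)" for t
  proof -
    have "(g has_field_derivative (\<Sum>B\<in>G. w B * (N B * exp (t * N B)))) (at t)"
      unfolding g_def by (auto intro!: derivative_eq_intros sum.cong simp: algebra_simps)
    then show ?thesis by (simp add: DERIV_imp_deriv)
  qed
  have dln: "deriv (\<lambda>t. ln (g t)) = (\<lambda>t. deriv g t / g t)"
  proof
    fix t
    have "((\<lambda>t. ln (g t)) has_field_derivative deriv g t / g t) (at t)"
      using pos[of t] dg[of t] by (auto intro!: derivative_eq_intros)
    then show "deriv (\<lambda>t. ln (g t)) t = deriv g t / g t" by (rule DERIV_imp_deriv)
  qed
  have KF: "K * F = fps_deriv F"
    using F0 unfolding K_def by (simp add: fps_divide_unit mult.assoc inverse_mult_eq_1)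
  have Kexp: "(\<lambda>t. deriv g t / g t) has_fps_expansion K"
    unfolding K_def using F F0 by (intro fps_expansion_intros) auto
  have cum: "(deriv ^^ j) (\<lambda>t. ln (g t)) 0 = fact (j - 1) * fps_nth K (j - 1)"
  proof -
    have "(deriv ^^ j) (\<lambda>t. ln (g t)) = (deriv ^^ (j - 1)) (deriv (\<lambda>t. ln (g t)))"
      using j by (metis Suc_diff_1 funpow_Suc_right o_apply)
    then show ?thesis using higher_deriv_at_0_fps[OF Kexp, of "j - 1"] by (simp add: dln)
  qed
  \<comment> \<open>\<open>FC r\<close> is the moment generating series of
    \<open>\<zeta> ^ r\<close> times the variable, that is, \<open>F\<close> with rescaled argument.
    \<open>KC r\<close> is its logarithmic derivative; the exponent \<open>i + 1\<close> is the
    order of the cumulant sitting in coefficient \<open>i\<close>.\<close>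
  define FC where "FC = (\<lambda>r. Abs_fps (\<lambda>i. \<zeta> ^ (r * i) * complex_of_real (fps_nth F i)))"
  define KC where "KC = (\<lambda>r. Abs_fps (\<lambda>i. \<zeta> ^ (r * (i + 1)) * complex_of_real (fps_nth K i)))"
  have der: "fps_deriv (FC r) = KC r * FC r" for r
  proof (rule fps_ext)
    fix i
    have "fps_nth (fps_deriv (FC r)) i = \<zeta> ^ (r * (i + 1)) * complex_of_real (fps_nth (fps_deriv F) i)"
      by (simp add: FC_def)
    also have "\<dots> = \<zeta> ^ (r * (i + 1)) *
        (\<Sum>l=0..i. complex_of_real (fps_nth K l) * complex_of_real (fps_nth F (i - l)))"
      unfolding KF[symmetric] fps_mult_nth by simp
    also have "\<dots> = (\<Sum>l=0..i. fps_nth (KC r) l * fps_nth (FC r) (i - l))"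
      unfolding sum_distrib_left
    proof (intro sum.cong refl)
      fix l assume "l \<in> {0..i}"
      then have "r * (i + 1) = r * (l + 1) + r * (i - l)" by (auto simp: add_mult_distrib2[symmetric])
      then show "\<zeta> ^ (r * (i + 1)) * (complex_of_real (fps_nth K l) * complex_of_real (fps_nth F (i - l))) =
         fps_nth (KC r) l * fps_nth (FC r) (i - l)"
        by (simp only: KC_def FC_def fps_nth_Abs_fps power_add) simp
    qed
    finally show "fps_nth (fps_deriv (FC r)) i = fps_nth (KC r * FC r) i"
      by (simp add: fps_mult_nth)
  qed
  define P where "P = (\<Prod>r<j. FC r)"
  define Q where "Q = (\<Sum>r<j. KC r)"
  have PQ: "fps_deriv P = Q * P"
    unfolding P_def Q_def by (intro fps_deriv_prod_log der)
  have Qi: "fps_nth Q i = (if j dvd i + 1 then of_nat j * complex_of_real (fps_nth K i) else 0)" for i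
  proof -
    have "fps_nth Q i = (\<Sum>r<j. \<zeta> ^ (r * (i + 1))) * complex_of_real (fps_nth K i)"
      unfolding Q_def fps_sum_nth KC_def sum_distrib_right by simp
    then show ?thesis unfolding \<zeta>_def sum_cis_powers[OF j] by simp
  qed
  have P0: "fps_nth P 0 = 1"
  proof -
    have "fps_nth (\<Prod>r<m. FC r) 0 = 1" for m
      by (induction m) (auto simp: FC_def F0)
    then show ?thesis by (simp add: P_def)
  qed
  have "of_nat j * fps_nth P j = fps_nth (fps_deriv P) (j - 1)"
    using j by simp
  also have "\<dots> = (\<Sum>l=0..j-1. fps_nth Q l * fps_nth P (j - 1 - l))"
    by (simp add: PQ fps_mult_nth)
  \<comment> \<open>For \<open>l < j - 1\<close> the number \<open>l + 1\<close> lies strictly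
    between 0 and \<open>j\<close>, so \<open>Qi\<close> makes the coefficient of \<open>Q\<close>
    vanish.\<close>
  also have "\<dots> = (\<Sum>l\<in>{j-1}. fps_nth Q l * fps_nth P (j - 1 - l))"
    using j by (intro sum.mono_neutral_right) (auto simp: Qi dest!: dvd_imp_le)
  also have "\<dots> = of_nat j * complex_of_real (fps_nth K (j - 1))"
    using j by (simp add: Qi P0)
  finally have PK: "fps_nth P j = complex_of_real (fps_nth K (j - 1))"
    using j by simp
  have FCr: "FC r = (\<Sum>B\<in>G. fps_const (of_real (w B)) * fps_exp (\<zeta> ^ r * of_real (N B)))" for r
    by (rule fps_ext) (simp add: FC_def F_def fps_sum_nth sum_distrib_left power_mult_distrib
        power_mult[symmetric] algebra_simps)
  have prod_exp: "(\<Prod>r<m. fps_exp (f r)) = fps_exp (\<Sum>r<m. f r)" for m and f :: "nat \<Rightarrow> complex"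
    by (induction m) (auto simp: fps_exp_add_mult)
  have prod_const: "(\<Prod>r<m. fps_const (f r)) = fps_const (\<Prod>r<m. f r)" for m and f :: "nat \<Rightarrow> complex"
    by (induction m) auto
  have "P = (\<Sum>b \<in> {..<j} \<rightarrow>\<^sub>E G. \<Prod>r<j. fps_const (of_real (w (b r))) * fps_exp (\<zeta> ^ r * of_real (N (b r))))"
    unfolding P_def FCr using assms(2) by (intro prod_sum_PiE) auto
  also have "\<dots> = (\<Sum>b \<in> {..<j} \<rightarrow>\<^sub>E G. fps_const (of_real (\<Prod>r<j. w (b r))) *
      fps_exp (\<Sum>r<j. \<zeta> ^ r * of_real (N (b r))))"
    by (simp add: prod.distrib prod_exp prod_const)
  finally have "fps_nth P j = (\<Sum>b \<in> {..<j} \<rightarrow>\<^sub>E G. of_real (\<Prod>r<j. w (b r)) *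
      (\<Sum>r<j. \<zeta> ^ r * of_real (N (b r))) ^ j / fact j)"
    by (simp add: fps_sum_nth)
  then have "(\<Sum>b \<in> {..<j} \<rightarrow>\<^sub>E G. of_real (\<Prod>r<j. w (b r)) *
      (\<Sum>r<j. \<zeta> ^ r * of_real (N (b r))) ^ j) = fact j * fps_nth P j"
    by (simp add: sum_divide_distrib[symmetric])
  also have "\<dots> = of_nat j * of_real (fact (j - 1) * fps_nth K (j - 1))"
    using j by (simp add: PK fact_reduce[of j])
  finally show ?thesis using cum unfolding g_def by simp
qed

text \<open>For a probability vector \<open>w\<close> this is the probability that the random set
  with law \<open>w\<close> contains \<open>S\<close>.\<close>

definition containment_weight :: "'e set set \<Rightarrow> ('e set \<Rightarrow> real) \<Rightarrow> 'e set \<Rightarrow> real" where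
  "containment_weight G w S = (\<Sum>B\<in>G. w B * of_bool (S \<subseteq> B))"

text \<open>Good's formula with the \<open>j\<close>-th power multiplied out. Factor
  \<open>i\<close> of the power selects a copy \<open>\<beta> i\<close> and the index
  \<open>f i\<close> of the replica in which this copy must be present; since the replicas are
  independent, the sum over \<open>b\<close> factorises over \<open>r\<close>.\<close>

lemma cumulant_indicator_sum_expansion:
  fixes w N :: "'e set \<Rightarrow> real" and G :: "'e set set" and j :: nat and I :: "'i set"
  defines "\<zeta> \<equiv> cis (2 * pi / j)"
  assumes G: "finite G" and I: "finite I" and w: "\<And>B. B \<in> G \<Longrightarrow> 0 \<le> w B" "sum w G = 1" and j: "0 < j"
    and N: "\<And>B. N B = c * (\<Sum>\<beta>\<in>I. of_bool (D \<beta> \<subseteq> B))"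
  shows "of_nat j * of_real ((deriv ^^ j) (\<lambda>t. ln (\<Sum>B\<in>G. w B * exp (t * N B))) 0) =
    of_real (c ^ j) * (\<Sum>\<beta> \<in> {..<j} \<rightarrow>\<^sub>E I. \<Sum>f \<in> {..<j} \<rightarrow>\<^sub>E {..<j}. \<zeta> ^ (\<Sum>i<j. f i) *
      of_real (\<Prod>r<j. containment_weight G w (\<Union>i\<in>{i\<in>{..<j}. f i = r}. D (\<beta> i))))"
proof -
  have pow: "(\<Sum>r<j. \<zeta> ^ r * of_real (N (b r))) ^ j = of_real (c ^ j) *
      (\<Sum>\<beta> \<in> {..<j} \<rightarrow>\<^sub>E I. \<Sum>f \<in> {..<j} \<rightarrow>\<^sub>E {..<j}. \<zeta> ^ (\<Sum>i<j. f i) *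
        of_real (\<Prod>r<j. of_bool ((\<Union>i\<in>{i\<in>{..<j}. f i = r}. D (\<beta> i)) \<subseteq> b r)))" for b
  proof -
    have ob: "complex_of_real (of_bool P) = of_bool P" for P
      by (cases P) auto
    have "(\<Sum>r<j. \<zeta> ^ r * complex_of_real (N (b r))) =
        of_real c * (\<Sum>\<beta>\<in>I. \<Sum>r<j. \<zeta> ^ r * of_bool (D \<beta> \<subseteq> b r))"
      by (subst sum.swap) (simp add: N sum_distrib_left algebra_simps ob)
    then have "(\<Sum>r<j. \<zeta> ^ r * complex_of_real (N (b r))) ^ j =
        of_real (c ^ j) * (\<Prod>i<j. \<Sum>\<beta>\<in>I. \<Sum>r<j. \<zeta> ^ r * of_bool (D \<beta> \<subseteq> b r))"
      by (simp add: power_mult_distrib)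
    also have "(\<Prod>i<j. \<Sum>\<beta>\<in>I. \<Sum>r<j. \<zeta> ^ r * of_bool (D \<beta> \<subseteq> b r)) =
        (\<Sum>\<beta> \<in> {..<j} \<rightarrow>\<^sub>E I. \<Prod>i<j. \<Sum>r<j. \<zeta> ^ r * of_bool (D (\<beta> i) \<subseteq> b r))"
      using I by (intro prod_sum_PiE) auto
    also have "\<dots> = (\<Sum>\<beta> \<in> {..<j} \<rightarrow>\<^sub>E I. \<Sum>f \<in> {..<j} \<rightarrow>\<^sub>E {..<j}.
        \<Prod>i<j. \<zeta> ^ f i * of_bool (D (\<beta> i) \<subseteq> b (f i)))"
      by (intro sum.cong refl prod_sum_PiE) auto
    also have "\<dots> = (\<Sum>\<beta> \<in> {..<j} \<rightarrow>\<^sub>E I. \<Sum>f \<in> {..<j} \<rightarrow>\<^sub>E {..<j}. \<zeta> ^ (\<Sum>i<j. f i) *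
        of_real (\<Prod>r<j. of_bool ((\<Union>i\<in>{i\<in>{..<j}. f i = r}. D (\<beta> i)) \<subseteq> b r)))"
    proof (intro sum.cong refl)
      fix \<beta> f assume f: "f \<in> {..<j} \<rightarrow>\<^sub>E {..<j}"
      have "(\<Prod>i<j. of_bool (D (\<beta> i) \<subseteq> b (f i)) :: complex) = of_bool (\<forall>i<j. D (\<beta> i) \<subseteq> b (f i))"
        by (auto simp: prod_zero_iff)
      also have "\<dots> = of_bool (\<forall>r<j. (\<Union>i\<in>{i\<in>{..<j}. f i = r}. D (\<beta> i)) \<subseteq> b r)"
      proof -
        have "(\<forall>i<j. D (\<beta> i) \<subseteq> b (f i)) \<longleftrightarrow> (\<forall>r<j. (\<Union>i\<in>{i\<in>{..<j}. f i = r}. D (\<beta> i)) \<subseteq> b r)"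
        proof (intro iffI allI impI)
          fix i assume H: "\<forall>r<j. (\<Union>i\<in>{i\<in>{..<j}. f i = r}. D (\<beta> i)) \<subseteq> b r" and i: "i < j"
          have "f i < j" using f i by auto
          with H have "(\<Union>i'\<in>{i'\<in>{..<j}. f i' = f i}. D (\<beta> i')) \<subseteq> b (f i)" by blast
          then show "D (\<beta> i) \<subseteq> b (f i)" using i by blast
        qed blast
        then show ?thesis by simp
      qed
      also have "\<dots> = of_real (\<Prod>r<j. of_bool ((\<Union>i\<in>{i\<in>{..<j}. f i = r}. D (\<beta> i)) \<subseteq> b r))"
        by (auto simp: prod_zero_iff)
      finally show "(\<Prod>i<j. \<zeta> ^ f i * of_bool (D (\<beta> i) \<subseteq> b (f i))) = \<zeta> ^ (\<Sum>i<j. f i) *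
        of_real (\<Prod>r<j. of_bool ((\<Union>i\<in>{i\<in>{..<j}. f i = r}. D (\<beta> i)) \<subseteq> b r))"
        by (simp add: prod.distrib power_sum)
    qed
    finally show ?thesis .
  qed
  have weight: "(\<Sum>b \<in> {..<j} \<rightarrow>\<^sub>E G. (\<Prod>r<j. w (b r)) * (\<Prod>r<j. of_bool (S r \<subseteq> b r))) =
      (\<Prod>r<j. containment_weight G w (S r))" for S
    unfolding containment_weight_def using G
    by (subst prod_sum_PiE) (auto simp: prod.distrib)
  have "of_nat j * of_real ((deriv ^^ j) (\<lambda>t. ln (\<Sum>B\<in>G. w B * exp (t * N B))) 0) =
    (\<Sum>b \<in> {..<j} \<rightarrow>\<^sub>E G. of_real (\<Prod>r<j. w (b r)) * (\<Sum>r<j. \<zeta> ^ r * of_real (N (b r))) ^ j)"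
    unfolding \<zeta>_def by (rule good_cumulant_formula[OF G w j])
  also have "\<dots> = (\<Sum>b \<in> {..<j} \<rightarrow>\<^sub>E G. of_real (\<Prod>r<j. w (b r)) * (of_real (c ^ j) *
      (\<Sum>\<beta> \<in> {..<j} \<rightarrow>\<^sub>E I. \<Sum>f \<in> {..<j} \<rightarrow>\<^sub>E {..<j}. \<zeta> ^ (\<Sum>i<j. f i) *
        of_real (\<Prod>r<j. of_bool ((\<Union>i\<in>{i\<in>{..<j}. f i = r}. D (\<beta> i)) \<subseteq> b r)))))"
    by (simp only: pow)
  also have "\<dots> = of_real (c ^ j) * (\<Sum>b \<in> {..<j} \<rightarrow>\<^sub>E G.
      \<Sum>\<beta> \<in> {..<j} \<rightarrow>\<^sub>E I. \<Sum>f \<in> {..<j} \<rightarrow>\<^sub>E {..<j}. \<zeta> ^ (\<Sum>i<j. f i) *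
        of_real ((\<Prod>r<j. w (b r)) * (\<Prod>r<j. of_bool ((\<Union>i\<in>{i\<in>{..<j}. f i = r}. D (\<beta> i)) \<subseteq> b r))))"
    unfolding sum_distrib_left of_real_mult by (simp only: mult_ac)
  also have "(\<Sum>b \<in> {..<j} \<rightarrow>\<^sub>E G.
      \<Sum>\<beta> \<in> {..<j} \<rightarrow>\<^sub>E I. \<Sum>f \<in> {..<j} \<rightarrow>\<^sub>E {..<j}. \<zeta> ^ (\<Sum>i<j. f i) *
        complex_of_real ((\<Prod>r<j. w (b r)) * (\<Prod>r<j. of_bool ((\<Union>i\<in>{i\<in>{..<j}. f i = r}. D (\<beta> i)) \<subseteq> b r)))) =
    (\<Sum>\<beta> \<in> {..<j} \<rightarrow>\<^sub>E I. \<Sum>f \<in> {..<j} \<rightarrow>\<^sub>E {..<j}. \<zeta> ^ (\<Sum>i<j. f i) *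
      of_real (\<Sum>b \<in> {..<j} \<rightarrow>\<^sub>E G.
        (\<Prod>r<j. w (b r)) * (\<Prod>r<j. of_bool ((\<Union>i\<in>{i\<in>{..<j}. f i = r}. D (\<beta> i)) \<subseteq> b r))))"
    by (subst sum.swap, intro sum.cong refl, subst sum.swap, simp only: of_real_sum sum_distrib_left)
  finally show ?thesis unfolding weight .
qed

text \<open>Otherwise every term of the sum in \<open>sum_cis_powers\<close> would be 1, although
  that sum vanishes because \<open>j\<close> does not divide \<open>a\<close>.\<close>

lemma cis_power_neq_1:
  assumes "0 < a" "a < j"
  shows "cis (2 * pi / real j) ^ a \<noteq> 1"
proof
  assume "cis (2 * pi / real j) ^ a = 1"
  then have "(\<Sum>r<j. cis (2 * pi / j) ^ (r * a)) = of_nat j"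
    by (simp add: mult.commute[of _ a] power_mult)
  moreover have "\<not> j dvd a" using assms by (auto dest: dvd_imp_le)
  ultimately show False using assms by (simp add: sum_cis_powers)
qed

lemma bij_betw_cyclic_shift:
  assumes "0 < j"
  shows "bij_betw (\<lambda>r. Suc r mod j) {..<j} {..<j}"
  by (rule bij_betwI[where g = "\<lambda>r. if r = 0 then j - 1 else r - 1"])
    (use assms in \<open>auto simp: mod_Suc\<close>)

text \<open>Shifting the values of \<open>f\<close> on \<open>A\<close> cyclically by one multiplies the sum by \<open>\<zeta> ^ card A \<noteq> 1\<close> and
  leaves it unchanged. This replaces the usual argument that joint cumulants vanish on independent
  groups.\<close>

lemma split_family_sum_eq_0:
  fixes W :: "nat set \<Rightarrow> real" and j :: nat
  defines "\<zeta> \<equiv> cis (2 * pi / j)"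
  assumes A: "A \<noteq> {}" "A \<subset> {..<j}"
    and W: "\<And>S. S \<subseteq> {..<j} \<Longrightarrow> W S = W (S \<inter> A) * W (S - A)"
  shows "(\<Sum>f \<in> {..<j} \<rightarrow>\<^sub>E {..<j}. \<zeta> ^ (\<Sum>i<j. f i) * of_real (\<Prod>r<j. W {i\<in>{..<j}. f i = r})) = 0"
proof -
  have j: "0 < j" using A by auto
  have \<zeta>j: "\<zeta> ^ j = 1" unfolding \<zeta>_def using j by (simp add: Complex.DeMoivre)
  have \<zeta>mod: "\<zeta> ^ (m mod j) = \<zeta> ^ m" for m
  proof -
    have "\<zeta> ^ m = \<zeta> ^ (m mod j + j * (m div j))" by simp
    also have "\<dots> = \<zeta> ^ (m mod j)" by (simp only: power_add power_mult \<zeta>j power_one mult_1_right)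
    finally show ?thesis ..
  qed
  define sh where "sh = (\<lambda>r. Suc r mod j)"
  have sh: "bij_betw sh {..<j} {..<j}" unfolding sh_def by (rule bij_betw_cyclic_shift[OF j])
  have sh_eq: "sh x = sh y \<longleftrightarrow> x = y" if "x < j" "y < j" for x y
    using inj_on_eq_iff[OF bij_betw_imp_inj_on[OF sh], of x y] that by simp
  define \<Phi> where "\<Phi> = (\<lambda>f::nat\<Rightarrow>nat. \<lambda>i\<in>{..<j}. if i \<in> A then sh (f i) else f i)"
  define T where "T = (\<lambda>f. \<zeta> ^ (\<Sum>i<j. f i) * complex_of_real (\<Prod>r<j. W {i\<in>{..<j}. f i = r}))"
  have inj: "inj_on \<Phi> ({..<j} \<rightarrow>\<^sub>E {..<j})"
  proof (rule inj_onI, rule PiE_ext)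
    fix f g i assume fg: "f \<in> {..<j} \<rightarrow>\<^sub>E {..<j}" "g \<in> {..<j} \<rightarrow>\<^sub>E {..<j}" "\<Phi> f = \<Phi> g" "i \<in> {..<j}"
    from fg(3) have "\<Phi> f i = \<Phi> g i" by simp
    moreover have "f i < j" "g i < j" using fg by auto
    ultimately show "f i = g i" using fg(4) by (auto simp: \<Phi>_def sh_eq split: if_splits)
  qed
  have into: "\<Phi> ` ({..<j} \<rightarrow>\<^sub>E {..<j}) \<subseteq> {..<j} \<rightarrow>\<^sub>E {..<j}"
  proof (rule image_subsetI)
    fix f assume f: "f \<in> {..<j} \<rightarrow>\<^sub>E {..<j}"
    have "f i < j" "sh (f i) < j" if "i < j" for i
      using f that j by (auto simp: sh_def)
    then show "\<Phi> f \<in> {..<j} \<rightarrow>\<^sub>E {..<j}"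
      unfolding \<Phi>_def restrict_PiE_iff by simp
  qed
  have bij: "bij_betw \<Phi> ({..<j} \<rightarrow>\<^sub>E {..<j}) ({..<j} \<rightarrow>\<^sub>E {..<j})"
    unfolding bij_betw_def using inj endo_inj_surj[OF finite_PiE into inj] by blast
  have T\<Phi>: "T (\<Phi> f) = \<zeta> ^ card A * T f" if f: "f \<in> {..<j} \<rightarrow>\<^sub>E {..<j}" for f
  proof -
    have "\<zeta> ^ (\<Sum>i<j. \<Phi> f i) = (\<Prod>i<j. (if i \<in> A then \<zeta> else 1) * \<zeta> ^ f i)"
      unfolding power_sum by (intro prod.cong refl) (auto simp: \<Phi>_def sh_def \<zeta>mod)
    also have "\<dots> = \<zeta> ^ card A * \<zeta> ^ (\<Sum>i<j. f i)"
      using A(2) by (simp add: prod.distrib power_sum prod.If_cases Int_absorb1 psubset_imp_subset)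
    finally have 1: "\<zeta> ^ (\<Sum>i<j. \<Phi> f i) = \<zeta> ^ card A * \<zeta> ^ (\<Sum>i<j. f i)" .
    \<comment> \<open>The factorisation of \<open>W\<close> separates the part of each class that is
      shifted from the part that stays.\<close>
    have split: "(\<Prod>r<j. W {i\<in>{..<j}. g i = r}) =
       (\<Prod>r<j. W ({i\<in>{..<j}. g i = r} \<inter> A)) * (\<Prod>r<j. W ({i\<in>{..<j}. g i = r} - A))" for g :: "nat \<Rightarrow> nat"
      unfolding prod.distrib[symmetric] by (intro prod.cong refl W) auto
    \<comment> \<open>Inside \<open>A\<close>, class \<open>sh r\<close> of \<open>\<Phi> f\<close>
      is class \<open>r\<close> of \<open>f\<close>, so the shift merely permutes the
      factors.\<close>
    have "(\<Prod>r<j. W ({i\<in>{..<j}. \<Phi> f i = r} \<inter> A)) = (\<Prod>r<j. W ({i\<in>{..<j}. \<Phi> f i = sh r} \<inter> A))"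
      using prod.reindex_bij_betw[OF sh, of "\<lambda>r. W ({i\<in>{..<j}. \<Phi> f i = r} \<inter> A)"] by simp
    also have "\<dots> = (\<Prod>r<j. W ({i\<in>{..<j}. f i = r} \<inter> A))"
    proof (intro prod.cong refl arg_cong[of _ _ W])
      fix r assume "r \<in> {..<j}"
      then show "{i \<in> {..<j}. \<Phi> f i = sh r} \<inter> A = {i \<in> {..<j}. f i = r} \<inter> A"
        using f by (auto simp: \<Phi>_def sh_eq PiE_iff)
    qed
    finally have 2: "(\<Prod>r<j. W ({i\<in>{..<j}. \<Phi> f i = r} \<inter> A)) = (\<Prod>r<j. W ({i\<in>{..<j}. f i = r} \<inter> A))" .
    have 3: "{i\<in>{..<j}. \<Phi> f i = r} - A = {i\<in>{..<j}. f i = r} - A" for r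
      by (auto simp: \<Phi>_def)
    have "(\<Prod>r<j. W {i\<in>{..<j}. \<Phi> f i = r}) = (\<Prod>r<j. W {i\<in>{..<j}. f i = r})"
      unfolding split 2 3 ..
    then show ?thesis unfolding T_def 1 by simp
  qed
  have "(\<Sum>f \<in> {..<j} \<rightarrow>\<^sub>E {..<j}. T f) = (\<Sum>f \<in> {..<j} \<rightarrow>\<^sub>E {..<j}. T (\<Phi> f))"
    using sum.reindex_bij_betw[OF bij, of T] by simp
  also have "\<dots> = \<zeta> ^ card A * (\<Sum>f \<in> {..<j} \<rightarrow>\<^sub>E {..<j}. T f)"
    by (simp add: T\<Phi> sum_distrib_left)
  finally have "(1 - \<zeta> ^ card A) * (\<Sum>f \<in> {..<j} \<rightarrow>\<^sub>E {..<j}. T f) = 0"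
    by (simp add: algebra_simps)
  moreover have "\<zeta> ^ card A \<noteq> 1"
  proof -
    have "finite A" using A(2) finite_subset by (metis finite_lessThan psubset_imp_subset)
    then have "0 < card A" using A(1) by (simp add: card_gt_0_iff)
    moreover have "card A < j" using psubset_card_mono[OF _ A(2)] by simp
    ultimately show ?thesis unfolding \<zeta>_def by (rule cis_power_neq_1)
  qed
  ultimately show ?thesis by (simp add: T_def)
qed

text \<open>A tuple contributes nothing if it splits; otherwise it contributes \<open>j ^ j\<close>
  terms, each of modulus at most \<open>u \<beta>\<close>. Dividing by the factor \<open>j\<close>
  of Good's formula leaves \<open>j ^ (j - 1)\<close>.\<close>

lemma cumulant_indicator_sum_bound:
  fixes w N :: "'e set \<Rightarrow> real" and G :: "'e set set" and j :: nat and I :: "'i set" and D :: "'i \<Rightarrow> 'e set"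
  defines "W \<equiv> \<lambda>\<beta> S. containment_weight G w (\<Union>i\<in>S. D (\<beta> i))"
  assumes G: "finite G" and I: "finite I" and w: "\<And>B. B \<in> G \<Longrightarrow> 0 \<le> w B" "sum w G = 1" and j: "0 < j"
    and N: "\<And>B. N B = c * (\<Sum>\<beta>\<in>I. of_bool (D \<beta> \<subseteq> B))" and c: "0 \<le> c"
    and u: "\<And>\<beta>. \<beta> \<in> {..<j} \<rightarrow>\<^sub>E I \<Longrightarrow> 0 \<le> u \<beta>"
    and dich: "\<And>\<beta>. \<beta> \<in> {..<j} \<rightarrow>\<^sub>E I \<Longrightarrow>
      (\<exists>A. A \<noteq> {} \<and> A \<subset> {..<j} \<and> (\<forall>S\<subseteq>{..<j}. W \<beta> S = W \<beta> (S \<inter> A) * W \<beta> (S - A))) \<or>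
      (\<forall>f \<in> {..<j} \<rightarrow>\<^sub>E {..<j}. (\<Prod>r<j. W \<beta> {i\<in>{..<j}. f i = r}) \<le> u \<beta>)"
  shows "\<bar>(deriv ^^ j) (\<lambda>t. ln (\<Sum>B\<in>G. w B * exp (t * N B))) 0\<bar>
    \<le> c ^ j * real j ^ (j - 1) * (\<Sum>\<beta> \<in> {..<j} \<rightarrow>\<^sub>E I. u \<beta>)"
proof -
  define \<zeta> where "\<zeta> = cis (2 * pi / j)"
  define \<kappa> where "\<kappa> = (deriv ^^ j) (\<lambda>t. ln (\<Sum>B\<in>G. w B * exp (t * N B))) 0"
  define R where "R = (\<lambda>\<beta>. \<Sum>f \<in> {..<j} \<rightarrow>\<^sub>E {..<j}. \<zeta> ^ (\<Sum>i<j. f i) *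
      complex_of_real (\<Prod>r<j. W \<beta> {i\<in>{..<j}. f i = r}))"
  have W0: "0 \<le> W \<beta> S" for \<beta> S
    unfolding W_def containment_weight_def using w by (intro sum_nonneg) auto
  have R: "norm (R \<beta>) \<le> real j ^ j * u \<beta>" if \<beta>: "\<beta> \<in> {..<j} \<rightarrow>\<^sub>E I" for \<beta>
    using dich[OF \<beta>]
  proof
    assume "\<exists>A. A \<noteq> {} \<and> A \<subset> {..<j} \<and> (\<forall>S\<subseteq>{..<j}. W \<beta> S = W \<beta> (S \<inter> A) * W \<beta> (S - A))"
    then obtain A where A: "A \<noteq> {}" "A \<subset> {..<j}"
        "\<forall>S\<subseteq>{..<j}. W \<beta> S = W \<beta> (S \<inter> A) * W \<beta> (S - A)"
      by (elim exE conjE)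
    have "R \<beta> = 0"
      unfolding R_def \<zeta>_def by (rule split_family_sum_eq_0[OF A(1,2)]) (rule A(3)[rule_format])
    then show ?thesis using u[OF \<beta>] by simp
  next
    assume *: "\<forall>f \<in> {..<j} \<rightarrow>\<^sub>E {..<j}. (\<Prod>r<j. W \<beta> {i\<in>{..<j}. f i = r}) \<le> u \<beta>"
    have "norm (R \<beta>) \<le> (\<Sum>f \<in> {..<j} \<rightarrow>\<^sub>E {..<j}. u \<beta>)"
      unfolding R_def
    proof (rule sum_norm_le)
      fix f assume f: "f \<in> {..<j} \<rightarrow>\<^sub>E {..<j}"
      have "norm (\<zeta> ^ (\<Sum>i<j. f i) * complex_of_real (\<Prod>r<j. W \<beta> {i\<in>{..<j}. f i = r})) =
          \<bar>\<Prod>r<j. W \<beta> {i\<in>{..<j}. f i = r}\<bar>"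
        by (simp only: norm_mult norm_power \<zeta>_def norm_cis power_one mult_1 norm_of_real)
      also have "\<dots> = (\<Prod>r<j. W \<beta> {i\<in>{..<j}. f i = r})"
        by (intro abs_of_nonneg prod_nonneg W0)
      also have "\<dots> \<le> u \<beta>" using * f by (rule bspec)
      finally show "norm (\<zeta> ^ (\<Sum>i<j. f i) *
          complex_of_real (\<Prod>r<j. W \<beta> {i\<in>{..<j}. f i = r})) \<le> u \<beta>" .
    qed
    then show ?thesis by (simp add: card_PiE)
  qed
  have "real j * \<bar>\<kappa>\<bar> = norm (of_nat j * complex_of_real \<kappa>)"
    by (simp add: norm_mult)
  also have "\<dots> = norm (of_real (c ^ j) * (\<Sum>\<beta> \<in> {..<j} \<rightarrow>\<^sub>E I. R \<beta>))"
    unfolding \<kappa>_def R_def \<zeta>_def W_def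
    by (subst cumulant_indicator_sum_expansion[OF G I w j N]) (rule refl | assumption)+
  also have "\<dots> = c ^ j * norm (\<Sum>\<beta> \<in> {..<j} \<rightarrow>\<^sub>E I. R \<beta>)"
    using c by (simp add: norm_mult norm_power)
  also have "\<dots> \<le> c ^ j * (\<Sum>\<beta> \<in> {..<j} \<rightarrow>\<^sub>E I. real j ^ j * u \<beta>)"
    using c R by (intro mult_left_mono sum_norm_le) auto
  also have "\<dots> = real j * (c ^ j * real j ^ (j - 1) * (\<Sum>\<beta> \<in> {..<j} \<rightarrow>\<^sub>E I. u \<beta>))"
    using j by (simp add: sum_distrib_left[symmetric] power_eq_if)
  finally show ?thesis using j unfolding \<kappa>_def by simp
qed

section \<open>Counting tuples of injections\<close>

text \<open>The probability that a random subset of \<open>Q\<close>, keeping points independently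
  with probability \<open>x\<close>, contains \<open>T\<close>: each point outside \<open>T\<close>
  sums out to \<open>x + (1 - x)\<close>.\<close>

lemma sum_bernoulli_superset_weights:
  fixes x :: real
  assumes "finite Q" "T \<subseteq> Q"
  shows "(\<Sum>R\<in>{R. T \<subseteq> R \<and> R \<subseteq> Q}. x ^ card R * (1 - x) ^ card (Q - R)) = x ^ card T"
proof -
  have T: "finite T" using assms finite_subset by blast
  have "(\<Sum>R\<in>{R. T \<subseteq> R \<and> R \<subseteq> Q}. x ^ card R * (1 - x) ^ card (Q - R)) =
      (\<Sum>R\<in>Pow (Q - T). x ^ card (T \<union> R) * (1 - x) ^ card (Q - (T \<union> R)))"
    using assms by (intro sum.reindex_bij_witness[of _ "\<lambda>R. T \<union> R" "\<lambda>R. R - T"]) (auto intro: arg_cong)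
  also have "\<dots> = (\<Sum>R\<in>Pow (Q - T). x ^ card T * ((\<Prod>i\<in>R. x) * (\<Prod>i\<in>Q - T - R. 1 - x)))"
  proof (intro sum.cong refl)
    fix R assume R: "R \<in> Pow (Q - T)"
    then have "card (T \<union> R) = card T + card R"
      using assms T finite_subset[of R Q] by (intro card_Un_disjoint) auto
    moreover have "Q - (T \<union> R) = Q - T - R" by auto
    ultimately show "x ^ card (T \<union> R) * (1 - x) ^ card (Q - (T \<union> R)) =
        x ^ card T * ((\<Prod>i\<in>R. x) * (\<Prod>i\<in>Q - T - R. 1 - x))"
      by (simp add: power_add)
  qed
  also have "\<dots> = x ^ card T * (\<Prod>i\<in>Q - T. x + (1 - x))"
    using assms by (simp only: sum_distrib_left[symmetric] prod_add[symmetric] finite_Diff)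
  finally show ?thesis by simp
qed

text \<open>The generating function of a binomial variable is
  \<open>(1 + x * (y - 1)) ^ card Q\<close>; then \<open>1 + z \<le> exp z\<close> and the bound 1
  on the mean apply.\<close>

lemma bernoulli_power_expectation_le:
  fixes x y :: real
  assumes "finite Q" "0 \<le> x" "real (card Q) * x \<le> 1" "1 \<le> y"
  shows "(\<Sum>R\<in>Pow Q. x ^ card R * (1 - x) ^ card (Q - R) * y ^ card R) \<le> exp (y - 1)"
proof -
  have "(\<Sum>R\<in>Pow Q. x ^ card R * (1 - x) ^ card (Q - R) * y ^ card R) =
      (\<Sum>R\<in>Pow Q. (\<Prod>i\<in>R. x * y) * (\<Prod>i\<in>Q - R. 1 - x))"
    by (intro sum.cong refl) (simp add: power_mult_distrib)
  also have "\<dots> = (\<Prod>i\<in>Q. x * y + (1 - x))"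
    by (rule prod_add[OF assms(1), symmetric])
  also have "\<dots> = (1 + x * (y - 1)) ^ card Q"
    by (simp add: algebra_simps)
  also have "\<dots> \<le> exp (x * (y - 1)) ^ card Q"
    using assms by (intro power_mono exp_ge_add_one_self) auto
  also have "\<dots> = exp (real (card Q) * x * (y - 1))"
    by (simp add: exp_of_nat_mult[symmetric] mult_ac)
  also have "\<dots> \<le> exp (y - 1)"
    using mult_right_mono[OF assms(3), of "y - 1"] assms(4) by simp
  finally show ?thesis .
qed

lemma card_inj_funcset:
  assumes "finite T" "card T = k + r"
  shows "card {\<beta> \<in> {1..k} \<rightarrow>\<^sub>E T. inj_on \<beta> {1..k}} = fact k * ((k + r) choose k)"
proof -
  have "card {\<beta> \<in> {1..k} \<rightarrow>\<^sub>E T. inj_on \<beta> {1..k}} = (\<Prod>i = 0..<k. k + r - i)"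
    using card_inj_on_subset_funcset[of "{1..k}" T "{1..k}"] assms by simp
  also have "\<dots> = fact k * ((k + r) choose k)"
  proof (induction k)
    case (Suc k)
    have "(\<Prod>i = 0..<Suc k. Suc k + r - i) = Suc (k + r) * (\<Prod>i = 0..<k. k + r - i)"
      by (subst prod.atLeast0_lessThan_Suc_shift) simp
    also have "\<dots> = fact k * (Suc (k + r) * ((k + r) choose k))"
      by (simp only: Suc.IH mult.left_commute)
    also have "\<dots> = fact (Suc k) * ((Suc k + r) choose Suc k)"
      by (simp only: Suc_times_binomial[symmetric] fact_Suc mult_ac add_Suc of_nat_id)
    finally show ?case .
  qed simp
  finally show ?thesis .
qed

section \<open>Estimates for binomial coefficients and harmonic numbers\<close>

lemma binomial_eq_prod:
  "real ((k + r) choose k) = (\<Prod>i=1..k. 1 + real r / real i)"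
proof (induction k)
  case (Suc k)
  have "real (Suc k) * real ((Suc k + r) choose Suc k) = real (Suc k + r) * real ((k + r) choose k)"
    using Suc_times_binomial[of k "k + r"] by (metis add_Suc of_nat_mult)
  then have "real ((Suc k + r) choose Suc k) = real ((k + r) choose k) * (1 + real r / real (Suc k))"
    by (simp add: field_simps)
  then show ?case using Suc by simp
qed simp

text \<open>The right side depends on \<open>r\<close> only through an \<open>r\<close>-th power,
  whose expectation over a binomial \<open>r\<close> is explicit. The parameter
  \<open>\<theta>\<close> stays free for tuning.\<close>

lemma binomial_power_le_exp:
  fixes \<theta> :: real
  assumes "0 < \<theta>" "0 < m"
  shows "real ((k + r) choose k) ^ m \<le>
    ((real m / \<theta>) ^ m * exp (\<theta> - real m)) ^ k * exp (\<theta> * harm k) ^ r"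
proof -
  have one: "(1 + real r / real i) ^ m \<le> (real m / \<theta>) ^ m * exp (\<theta> - real m) * exp (\<theta> * inverse (real i)) ^ r"
    for i
  proof -
    define y where "y = 1 + real r / real i"
    \<comment> \<open>The tangent bound \<open>z \<le> exp (z - 1)\<close>, with equality at
      \<open>\<theta> * y = m\<close>.\<close>
    have "\<theta> * y / m \<le> exp (\<theta> * y / m - 1)"
      using exp_ge_add_one_self[of "\<theta> * y / m - 1"] by simp
    then have "(\<theta> * y / m) ^ m \<le> exp (\<theta> * y / m - 1) ^ m"
      using assms by (intro power_mono) (auto simp: y_def)
    also have "\<dots> = exp (\<theta> * y - m)"
      using assms by (simp add: exp_of_nat_mult[symmetric] algebra_simps)
    also have "\<dots> = exp (\<theta> - m) * exp (\<theta> * inverse (real i)) ^ r"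
      by (simp add: exp_of_nat_mult[symmetric] exp_add[symmetric] y_def field_simps)
    finally have "(m / \<theta>) ^ m * (\<theta> * y / m) ^ m \<le>
        (m / \<theta>) ^ m * (exp (\<theta> - m) * exp (\<theta> * inverse (real i)) ^ r)"
      using assms by (intro mult_left_mono) auto
    moreover have "(m / \<theta>) ^ m * (\<theta> * y / m) ^ m = y ^ m"
      using assms by (simp add: power_mult_distrib[symmetric])
    ultimately show ?thesis by (simp add: y_def mult_ac)
  qed
  have "real ((k + r) choose k) ^ m = (\<Prod>i=1..k. (1 + real r / real i) ^ m)"
    by (simp add: binomial_eq_prod prod_power_distrib)
  also have "\<dots> \<le> (\<Prod>i=1..k. (real m / \<theta>) ^ m * exp (\<theta> - real m) * exp (\<theta> * inverse (real i)) ^ r)"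
    by (intro prod_mono) (auto simp: one)
  also have "\<dots> = ((real m / \<theta>) ^ m * exp (\<theta> - real m)) ^ k * exp (\<theta> * harm k) ^ r"
    by (simp add: prod.distrib prod_power_distrib[symmetric] exp_sum[symmetric] harm_def sum_distrib_left
        power_mult_distrib)
  finally show ?thesis .
qed

text \<open>Gives \<open>exp (harm k) - 1 \<le> 9/5 * k\<close>, the linear bound for
  \<open>\<theta> = 1\<close>. The shift \<open>1/2\<close> suits the induction, because
  \<open>k + 1\<close> is the midpoint between \<open>k + 1/2\<close> and
  \<open>k + 3/2\<close>.\<close>

lemma exp_harm_le:
  assumes "2 \<le> k"
  shows "exp (harm k :: real) \<le> 9/5 * (real k + 1/2)"
  using assms
proof (induction k rule: dec_induct)
  case base
  \<comment> \<open>At \<open>k = 2\<close> the claim is \<open>exp (3/2) \<le> 9/2\<close>;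
    squared, it reads \<open>exp 1 ^ 3 \<le> 81/4\<close>, which the bound 2.72 just yields.\<close>
  have "exp (3/2::real) ^ 2 = exp 1 ^ 3"
    by (simp add: exp_of_nat_mult[symmetric])
  also have "\<dots> \<le> (272/100) ^ 3"
    using e_less_272 by (intro power_mono) auto
  also have "\<dots> \<le> (9/2) ^ 2" by (simp add: power_numeral_reduce)
  finally have "exp (3/2::real) \<le> 9/2" by (rule power2_le_imp_le) simp
  then show ?case by (simp add: harm_expand)
next
  case (step k)
  \<comment> \<open>By convexity of the reciprocal, its integral over this unit interval is at least
    its value at the midpoint \<open>k + 1\<close>.\<close>
  have "ln (real k + 3/2) - ln (real k + 1/2) \<ge> 2 / (2 * real k + 2)"
    using ln_inverse_approx_ge[of "real k + 1/2" "real k + 3/2"] by (simp add: algebra_simps)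
  moreover have "2 / (2 * real k + 2) = inverse (real (Suc k))"
    by (simp add: field_simps)
  ultimately have "inverse (real (Suc k)) \<le> ln ((real k + 3/2) / (real k + 1/2))"
    by (simp add: ln_div)
  then have "exp (inverse (real (Suc k))) \<le> (real k + 3/2) / (real k + 1/2)"
    by (metis add_pos_pos divide_pos_pos exp_le_cancel_iff exp_ln of_nat_0_le_iff
        add_nonneg_pos zero_less_divide_iff zero_less_numeral zero_less_one)
  then have "exp (harm (Suc k)) \<le> exp (harm k) * ((real k + 3/2) / (real k + 1/2))"
    by (simp add: harm_Suc exp_add del: times_divide_eq_right)
  also have "\<dots> \<le> 9/5 * (real k + 1/2) * ((real k + 3/2) / (real k + 1/2))"
    using step by (intro mult_right_mono) auto
  also have "\<dots> = 9/5 * (real (Suc k) + 1/2)"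
    by (simp add: field_simps)
  finally show ?case .
qed

text \<open>The linear bound for \<open>\<theta> = 2/3\<close>, with slope \<open>9/10\<close>. At
  \<open>k = 2\<close> the exponent is exactly 1.\<close>

lemma exp_two_thirds_harm_le:
  assumes "2 \<le> k"
  shows "exp (2/3 * harm k :: real) \<le> 1 + 9/10 * real k"
  using assms
proof (induction k rule: dec_induct)
  case base
  have "exp (1::real) \<le> 28/10" using e_less_272 by simp
  then show ?case by (simp add: harm_expand)
next
  case (step k)
  define x where "x = 2 / (3 * (real k + 1))"
  have x: "0 < x" "x < 1" using step by (auto simp: x_def field_simps)
  have "1 - x \<le> exp (- x)" using exp_ge_add_one_self[of "-x"] by simp
  then have "exp x \<le> 1 / (1 - x)" using x by (simp add: exp_minus field_simps)
  also have "\<dots> = (3 * real k + 3) / (3 * real k + 1)" by (simp add: x_def field_simps)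
  finally have ex: "exp x \<le> (3 * real k + 3) / (3 * real k + 1)" .
  have "exp (2/3 * harm (Suc k)) = exp (2/3 * harm k) * exp x"
    by (simp add: harm_Suc exp_add[symmetric] x_def field_simps)
  also have "\<dots> \<le> (1 + 9/10 * real k) * ((3 * real k + 3) / (3 * real k + 1))"
    using step ex by (intro mult_mono) auto
  \<comment> \<open>Cleared of denominators this is \<open>11 \<le> 9 * k\<close>, which holds from
    \<open>k = 2\<close> on.\<close>
  also have "\<dots> \<le> 1 + 9/10 * real (Suc k)"
    using step by (simp add: field_simps)
  finally show ?case .
qed

text \<open>Here \<open>14/5\<close> is \<open>\<theta> + a\<close> for \<open>\<theta> = 1\<close>
  and slope \<open>a = 9/5\<close>. In one step the left side grows by a factor of at most
  \<open>m + 1\<close>, as \<open>(1 + 1/m) ^ m \<le> exp 1\<close>, and the right side by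
  \<open>m + 2\<close>. At \<open>m = 2\<close> the inequality fails.\<close>

lemma exp_power_le_fact:
  assumes "3 \<le> m"
  shows "real m ^ m * exp (14/5 - real m) \<le> fact (Suc m)"
  using assms
proof (induction m rule: dec_induct)
  case base
  \<comment> \<open>The base case is \<open>27 * exp (-1/5) \<le> 24\<close>.\<close>
  have "6/5 \<le> exp (1/5::real)" using exp_ge_add_one_self[of "1/5"] by simp
  then have "exp (-1/5::real) \<le> 5/6" by (simp add: exp_minus field_simps)
  then show ?case by (simp add: fact_numeral)
next
  case (step m)
  have m: "0 < m" using step by simp
  have "real (Suc m) ^ m = real m ^ m * (1 + 1 / real m) ^ m"
    using m by (simp add: power_mult_distrib[symmetric] field_simps)
  also have "\<dots> \<le> real m ^ m * exp (1 / real m) ^ m"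
    by (intro mult_left_mono power_mono exp_ge_add_one_self) auto
  also have "exp (1 / real m) ^ m = exp 1"
    using m by (simp add: exp_of_nat_mult[symmetric])
  finally have pow: "real (Suc m) ^ m \<le> real m ^ m * exp 1" .
  have "real (Suc m) ^ Suc m * exp (14/5 - real (Suc m)) =
      real (Suc m) * exp (14/5 - real m - 1) * real (Suc m) ^ m"
    by (simp add: algebra_simps)
  also have "\<dots> \<le> real (Suc m) * exp (14/5 - real m - 1) * (real m ^ m * exp 1)"
    using pow by (intro mult_left_mono) auto
  also have "\<dots> = real (Suc m) * (real m ^ m * (exp (14/5 - real m - 1) * exp 1))"
    by (simp only: mult_ac)
  also have "exp (14/5 - real m - 1) * exp 1 = exp (14/5 - real m)"
    by (simp flip: exp_add)
  also have "real (Suc m) * (real m ^ m * exp (14/5 - real m)) \<le> real (Suc m) * fact (Suc m)"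
    by (rule mult_left_mono[OF step.IH]) simp
  also have "\<dots> \<le> fact (Suc (Suc m))"
    by simp
  finally show ?case .
qed

text \<open>Counting the \<open>i\<close>-subsets \<open>T\<close> of \<open>R\<close> and
  exchanging sums gives the factorial moment \<open>(card Q choose i) * x ^ i\<close>, which is at
  most \<open>(card Q * x) ^ i\<close>.\<close>

lemma bernoulli_binomial_expectation_le_1:
  fixes x :: real
  assumes Q: "finite Q" and x: "0 \<le> x" "x \<le> 1" "real (card Q) * x \<le> 1"
  shows "(\<Sum>R\<in>Pow Q. x ^ card R * (1 - x) ^ card (Q - R) * real (card R choose i)) \<le> 1"
proof -
  have "(\<Sum>R\<in>Pow Q. x ^ card R * (1 - x) ^ card (Q - R) * real (card R choose i)) =
      (\<Sum>R\<in>Pow Q. \<Sum>T\<in>{T. T \<subseteq> R \<and> card T = i}. x ^ card R * (1 - x) ^ card (Q - R))"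
    using Q by (intro sum.cong refl) (simp add: n_subsets finite_subset)
  also have "\<dots> = (\<Sum>R\<in>Pow Q. \<Sum>T | T \<in> {T. T \<subseteq> Q \<and> card T = i} \<and> T \<subseteq> R. x ^ card R * (1 - x) ^ card (Q - R))"
    by (intro sum.cong refl) auto
  also have "\<dots> = (\<Sum>T\<in>{T. T \<subseteq> Q \<and> card T = i}. \<Sum>R | R \<in> Pow Q \<and> T \<subseteq> R. x ^ card R * (1 - x) ^ card (Q - R))"
    using Q by (intro sum.swap_restrict) auto
  also have "\<dots> = (\<Sum>T\<in>{T. T \<subseteq> Q \<and> card T = i}. x ^ i)"
  proof (intro sum.cong refl)
    fix T assume T: "T \<in> {T. T \<subseteq> Q \<and> card T = i}"
    have "{R. R \<in> Pow Q \<and> T \<subseteq> R} = {R. T \<subseteq> R \<and> R \<subseteq> Q}" by auto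
    then show "(\<Sum>R | R \<in> Pow Q \<and> T \<subseteq> R. x ^ card R * (1 - x) ^ card (Q - R)) = x ^ i"
      using sum_bernoulli_superset_weights[OF Q, of T x] T by simp
  qed
  also have "\<dots> = real (card Q choose i) * x ^ i"
    using Q by (simp add: n_subsets)
  also have "\<dots> \<le> 1"
  proof (cases "i \<le> card Q")
    case True
    then have "real (card Q choose i) \<le> real (card Q) ^ i"
      using binomial_le_pow[OF True] by (metis of_nat_le_iff of_nat_power)
    then have "real (card Q choose i) * x ^ i \<le> (real (card Q) * x) ^ i"
      using x by (simp add: power_mult_distrib mult_right_mono)
    also have "\<dots> \<le> 1" using x by (intro power_le_one) auto
    finally show ?thesis .
  qed (simp add: binomial_eq_0)
  finally show ?thesis .
qed

text \<open>The case \<open>m = 1\<close> is Vandermonde's identity. For larger \<open>m\<close> the binomial coefficient is compared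
  with an exponential through \<open>y \<le> exp (\<theta> y / m - 1) m / \<theta>\<close>; \<open>\<theta> = 1\<close> is good enough for \<open>m \<ge> 3\<close> but
  not for \<open>m = 2\<close>, where \<open>\<theta> = 2/3\<close> is used.\<close>

lemma bernoulli_binomial_moment_le:
  fixes x :: real
  assumes Q: "finite Q" and x: "0 \<le> x" "x \<le> 1" "real (card Q) * x \<le> 1"
    and k: "2 \<le> k" and m: "1 \<le> m"
  shows "(\<Sum>R\<in>Pow Q. x ^ card R * (1 - x) ^ card (Q - R) * real ((k + card R) choose k) ^ m) \<le> fact (Suc m) ^ k"
    (is "?E \<le> _")
proof -
  have w0: "0 \<le> x ^ card R * (1 - x) ^ card (Q - R)" for R
    using x by simp
  \<comment> \<open>With a linear bound \<open>a * k\<close> on the exponent, all factors become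
    \<open>k\<close>-th powers, and only a numerical inequality free of \<open>k\<close> remains to
    be checked.\<close>
  have gen: "?E \<le> fact (Suc m) ^ k"
    if \<theta>: "0 < \<theta>" and a: "exp (\<theta> * harm k) - 1 \<le> a * real k"
      and le: "(real m / \<theta>) ^ m * exp (\<theta> - real m) * exp a \<le> fact (Suc m)" for \<theta> a
  proof -
    define c where "c = (real m / \<theta>) ^ m * exp (\<theta> - real m)"
    have "?E \<le> (\<Sum>R\<in>Pow Q. x ^ card R * (1 - x) ^ card (Q - R) * (c ^ k * exp (\<theta> * harm k) ^ card R))"
      unfolding c_def using \<theta> m w0
      by (intro sum_mono mult_left_mono binomial_power_le_exp) auto
    also have "\<dots> = c ^ k * (\<Sum>R\<in>Pow Q. x ^ card R * (1 - x) ^ card (Q - R) * exp (\<theta> * harm k) ^ card R)"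
      by (simp add: sum_distrib_left mult_ac)
    also have "\<dots> \<le> c ^ k * exp (exp (\<theta> * harm k) - 1)"
      using \<theta> x Q by (intro mult_left_mono bernoulli_power_expectation_le) (auto simp: c_def harm_nonneg)
    also have "\<dots> \<le> c ^ k * exp (a * real k)"
      using a \<theta> by (intro mult_left_mono) (auto simp: c_def)
    also have "\<dots> = (c * exp a) ^ k"
      by (simp add: power_mult_distrib exp_of_nat2_mult)
    also have "\<dots> \<le> fact (Suc m) ^ k"
      using le \<theta> by (intro power_mono) (auto simp: c_def)
    finally show ?thesis .
  qed
  consider "m = 1" | "m = 2" | "3 \<le> m" using m by linarith
  then show ?thesis
  proof cases
    case 1
    have V: "real ((k + r) choose k) = (\<Sum>i\<le>k. real (k choose i) * real (r choose (k - i)))" for r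
      using arg_cong[OF vandermonde[of k r k], of real] by simp
    have "?E = (\<Sum>R\<in>Pow Q. \<Sum>i\<le>k. real (k choose i) *
        (x ^ card R * (1 - x) ^ card (Q - R) * real (card R choose (k - i))))"
      by (simp only: 1 V power_one_right sum_distrib_left mult_ac)
    also have "\<dots> = (\<Sum>i\<le>k. real (k choose i) *
        (\<Sum>R\<in>Pow Q. x ^ card R * (1 - x) ^ card (Q - R) * real (card R choose (k - i))))"
      by (subst sum.swap) (simp add: sum_distrib_left)
    also have "\<dots> \<le> (\<Sum>i\<le>k. real (k choose i) * 1)"
      using Q x by (intro sum_mono mult_left_mono bernoulli_binomial_expectation_le_1) auto
    also have "\<dots> = 2 ^ k"
      using choose_row_sum[of k] by (simp flip: of_nat_sum)
    finally show ?thesis using 1 by (simp add: fact_numeral numeral_2_eq_2)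
  next
    case 2
    \<comment> \<open>Since \<open>2/3 - 2 + 9/10 = -13/30\<close>, the required
      \<open>9 * exp (-13/30) \<le> 6\<close> means \<open>3/2 \<le> exp (13/30)\<close>; the
      quadratic Taylor term is what reaches \<open>3/2\<close>.\<close>
    have "1 + 13/30 + (13/30)\<^sup>2 / 2 \<le> exp (13/30::real)"
      by (rule exp_lower_Taylor_quadratic) simp
    then have "3/2 \<le> exp (13/30::real)" by (simp add: power2_eq_square)
    then have "exp (-13/30::real) \<le> 2/3" by (simp add: exp_minus field_simps)
    moreover have "(real m / (2/3)) ^ m * exp (2/3 - real m) * exp (9/10) = 9 * exp (-13/30)"
      by (simp add: 2 power2_eq_square exp_add[symmetric] mult.assoc)
    ultimately have "(real m / (2/3)) ^ m * exp (2/3 - real m) * exp (9/10) \<le> fact (Suc m)"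
      by (simp add: 2 fact_numeral)
    then show ?thesis
      using exp_two_thirds_harm_le[OF k] by (intro gen[of "2/3" "9/10"]) auto
  next
    case 3
    have "exp (1 - real m) * exp (9/5) = exp (14/5 - real m)"
      by (simp flip: exp_add)
    then have "(real m / 1) ^ m * exp (1 - real m) * exp (9/5) \<le> fact (Suc m)"
      using exp_power_le_fact[OF 3] by (simp only: mult.assoc div_by_1)
    then show ?thesis
      using exp_harm_le[OF k] by (intro gen[of 1 "9/5"]) (auto simp: algebra_simps)
  qed
qed

section \<open>Sums over tuples of injections\<close>

definition injections :: "nat \<Rightarrow> nat \<Rightarrow> (nat \<Rightarrow> nat) set" where
  "injections k n = {\<beta> \<in> {1..k} \<rightarrow>\<^sub>E {1..n}. inj_on \<beta> {1..k}}"

lemma finite_injections: "finite (injections k n)"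
  unfolding injections_def by (rule finite_subset[where B = "{1..k} \<rightarrow>\<^sub>E {1..n}"]) (auto simp: finite_PiE)

text \<open>The weight \<open>n ^ (- card (V - B))\<close> is the probability that \<open>V - B\<close> is contained in the random set
  \<open>R\<close> that keeps each point outside \<open>B\<close> independently with probability \<open>1 / n\<close>, so the sum is the
  expectation of the \<open>m\<close>-th power of the number of injections into \<open>B \<union> R\<close>.\<close>

lemma sum_injection_tuples_avoiding_le:
  assumes n: "1 \<le> n" and k: "2 \<le> k" and m: "1 \<le> m" and B: "B \<subseteq> {1..n}" "card B = k"
  shows "(\<Sum>\<beta> \<in> {..<m} \<rightarrow>\<^sub>E injections k n. (1 / real n) ^ card ((\<Union>i<m. \<beta> i ` {1..k}) - B))
    \<le> fact (Suc m) ^ k * fact k ^ m"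
proof -
  define x where "x = 1 / real n"
  define Q where "Q = {1..n} - B"
  define wt where "wt = (\<lambda>R. x ^ card R * (1 - x) ^ card (Q - R))"
  have x: "0 \<le> x" "x \<le> 1" using n by (auto simp: x_def)
  have Q: "finite Q" "real (card Q) * x \<le> 1"
    using n card_mono[of "{1..n}" Q] by (auto simp: Q_def x_def field_simps)
  have finB: "finite B" using B finite_subset by blast
  have step: "x ^ card ((\<Union>i<m. \<beta> i ` {1..k}) - B) =
      (\<Sum>R\<in>Pow Q. wt R * of_bool (\<forall>i<m. \<beta> i ` {1..k} \<subseteq> B \<union> R))"
    if "\<beta> \<in> {..<m} \<rightarrow>\<^sub>E injections k n" for \<beta>
  proof -
    let ?T = "(\<Union>i<m. \<beta> i ` {1..k}) - B"
    have "\<beta> i ` {1..k} \<subseteq> {1..n}" if "i < m" for i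
      using \<open>\<beta> \<in> _\<close> that by (fastforce simp: injections_def PiE_iff)
    then have T: "?T \<subseteq> Q" unfolding Q_def by blast
    have "x ^ card ?T = (\<Sum>R\<in>{R. ?T \<subseteq> R \<and> R \<subseteq> Q}. wt R)"
      unfolding wt_def by (rule sum_bernoulli_superset_weights[OF Q(1) T, symmetric])
    also have "\<dots> = (\<Sum>R\<in>Pow Q. wt R * of_bool (?T \<subseteq> R))"
      using Q by (intro sum.mono_neutral_cong_left) auto
    also have "\<dots> = (\<Sum>R\<in>Pow Q. wt R * of_bool (\<forall>i<m. \<beta> i ` {1..k} \<subseteq> B \<union> R))"
      by (intro sum.cong refl arg_cong2[of _ _ _ _ "(*)"] arg_cong[of _ _ of_bool]) blast
    finally show ?thesis .
  qed
  have count: "(\<Sum>\<beta> \<in> {..<m} \<rightarrow>\<^sub>E injections k n. of_bool (\<forall>i<m. \<beta> i ` {1..k} \<subseteq> B \<union> R)) =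
      (fact k * real ((k + card R) choose k)) ^ m" if R: "R \<in> Pow Q" for R
  proof -
    have finR: "finite R" using R Q finite_subset by blast
    have BR: "B \<union> R \<subseteq> {1..n}" "finite (B \<union> R)" "card (B \<union> R) = k + card R"
      using B R finB finR by (auto simp: Q_def intro!: card_Un_disjoint)
    have "{\<beta> \<in> {..<m} \<rightarrow>\<^sub>E injections k n. \<forall>i<m. \<beta> i ` {1..k} \<subseteq> B \<union> R} =
        {..<m} \<rightarrow>\<^sub>E {\<gamma> \<in> injections k n. \<gamma> ` {1..k} \<subseteq> B \<union> R}"
      unfolding set_eq_iff PiE_iff mem_Collect_eq lessThan_iff Ball_def by blast
    moreover have "{\<gamma> \<in> injections k n. \<gamma> ` {1..k} \<subseteq> B \<union> R} =
        {\<beta> \<in> {1..k} \<rightarrow>\<^sub>E B \<union> R. inj_on \<beta> {1..k}}"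
    proof -
      have "\<gamma> \<in> {1..k} \<rightarrow>\<^sub>E {1..n} \<and> \<gamma> ` {1..k} \<subseteq> B \<union> R \<longleftrightarrow> \<gamma> \<in> {1..k} \<rightarrow>\<^sub>E B \<union> R" for \<gamma>
        using BR(1) unfolding PiE_iff image_subset_iff by blast
      then show ?thesis unfolding injections_def by blast
    qed
    moreover have "(\<Sum>\<beta> \<in> {..<m} \<rightarrow>\<^sub>E injections k n. of_bool (\<forall>i<m. \<beta> i ` {1..k} \<subseteq> B \<union> R)) =
        real (card {\<beta> \<in> {..<m} \<rightarrow>\<^sub>E injections k n. \<forall>i<m. \<beta> i ` {1..k} \<subseteq> B \<union> R})"
      by (simp add: finite_PiE finite_injections Int_def of_bool_def sum.If_cases)
    ultimately show ?thesis
      by (simp add: card_PiE card_inj_funcset[OF BR(2,3)] del: One_nat_def)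
  qed
  have "(\<Sum>\<beta> \<in> {..<m} \<rightarrow>\<^sub>E injections k n. x ^ card ((\<Union>i<m. \<beta> i ` {1..k}) - B)) =
      (\<Sum>\<beta> \<in> {..<m} \<rightarrow>\<^sub>E injections k n. \<Sum>R\<in>Pow Q. wt R * of_bool (\<forall>i<m. \<beta> i ` {1..k} \<subseteq> B \<union> R))"
    by (intro sum.cong refl step)
  also have "\<dots> = (\<Sum>R\<in>Pow Q. wt R * (fact k * real ((k + card R) choose k)) ^ m)"
    by (subst sum.swap) (simp only: sum_distrib_left[symmetric] count cong: sum.cong)
  also have "\<dots> = (\<Sum>R\<in>Pow Q. wt R * real ((k + card R) choose k) ^ m) * fact k ^ m"
    unfolding sum_distrib_right by (simp only: power_mult_distrib mult_ac)
  also have "\<dots> \<le> fact (Suc m) ^ k * fact k ^ m"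
    unfolding wt_def using bernoulli_binomial_moment_le[OF Q(1) x Q(2) k m]
    by (intro mult_right_mono) auto
  finally show ?thesis unfolding x_def .
qed

text \<open>The last injection \<open>\<gamma>\<close> serves as reference: its image is the set
  \<open>B\<close> of the preceding lemma for the other \<open>m\<close>. Its own weight
  \<open>n ^ (- k)\<close> cancels against the at most \<open>n ^ k\<close> choices of
  \<open>\<gamma>\<close>.\<close>

lemma sum_injection_tuples_le:
  assumes n: "1 \<le> n" and k: "2 \<le> k" and m: "1 \<le> m"
  shows "(\<Sum>\<beta> \<in> {..<Suc m} \<rightarrow>\<^sub>E injections k n. (1 / real n) ^ card (\<Union>i<Suc m. \<beta> i ` {1..k}))
    \<le> fact (Suc m) ^ k * fact k ^ m"
proof -
  define x where "x = 1 / real n"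
  have x: "0 \<le> x" using n by (auto simp: x_def)
  have "(\<Sum>\<beta> \<in> {..<Suc m} \<rightarrow>\<^sub>E injections k n. x ^ card (\<Union>i<Suc m. \<beta> i ` {1..k})) =
      (\<Sum>(\<gamma>, \<beta>) \<in> injections k n \<times> ({..<m} \<rightarrow>\<^sub>E injections k n).
        x ^ card (\<Union>i<Suc m. (\<beta>(m := \<gamma>)) i ` {1..k}))"
    unfolding lessThan_Suc PiE_insert_eq
    by (subst sum.reindex[OF inj_combinator]) (auto simp: case_prod_beta)
  also have "\<dots> = (\<Sum>\<gamma>\<in>injections k n. \<Sum>\<beta>\<in>{..<m} \<rightarrow>\<^sub>E injections k n.
      x ^ k * x ^ card ((\<Union>i<m. \<beta> i ` {1..k}) - \<gamma> ` {1..k}))"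
  proof (subst sum.cartesian_product[symmetric], intro sum.cong refl)
    fix \<gamma> \<beta> assume \<gamma>: "\<gamma> \<in> injections k n" and \<beta>: "\<beta> \<in> {..<m} \<rightarrow>\<^sub>E injections k n"
    have eq: "(\<Union>i<Suc m. (\<beta>(m := \<gamma>)) i ` {1..k}) =
        \<gamma> ` {1..k} \<union> ((\<Union>i<m. \<beta> i ` {1..k}) - \<gamma> ` {1..k})"
      by (auto simp: lessThan_Suc)
    have "card (\<Union>i<Suc m. (\<beta>(m := \<gamma>)) i ` {1..k}) =
        card (\<gamma> ` {1..k}) + card ((\<Union>i<m. \<beta> i ` {1..k}) - \<gamma> ` {1..k})"
      unfolding eq by (intro card_Un_disjoint) auto
    also have "card (\<gamma> ` {1..k}) = k"
      using \<gamma> by (simp add: injections_def card_image)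
    finally show "x ^ card (\<Union>i<Suc m. (\<beta>(m := \<gamma>)) i ` {1..k}) =
        x ^ k * x ^ card ((\<Union>i<m. \<beta> i ` {1..k}) - \<gamma> ` {1..k})"
      by (simp add: power_add)
  qed
  also have "\<dots> \<le> (\<Sum>\<gamma>\<in>injections k n. x ^ k * (fact (Suc m) ^ k * fact k ^ m))"
  proof (rule sum_mono)
    fix \<gamma> assume "\<gamma> \<in> injections k n"
    then have \<gamma>: "\<gamma> ` {1..k} \<subseteq> {1..n}" "card (\<gamma> ` {1..k}) = k"
      by (auto simp: injections_def card_image)
    show "(\<Sum>\<beta>\<in>{..<m} \<rightarrow>\<^sub>E injections k n. x ^ k * x ^ card ((\<Union>i<m. \<beta> i ` {1..k}) - \<gamma> ` {1..k}))
        \<le> x ^ k * (fact (Suc m) ^ k * fact k ^ m)"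
      unfolding sum_distrib_left[symmetric] x_def
      by (intro mult_left_mono sum_injection_tuples_avoiding_le[OF n k m \<gamma>]) simp
  qed
  also have "\<dots> = real (card (injections k n)) * x ^ k * (fact (Suc m) ^ k * fact k ^ m)"
    by simp
  also have "\<dots> \<le> real n ^ k * x ^ k * (fact (Suc m) ^ k * fact k ^ m)"
  proof (intro mult_right_mono)
    have "card (injections k n) \<le> card ({1..k} \<rightarrow>\<^sub>E {1..n})"
      unfolding injections_def by (intro card_mono finite_PiE) auto
    then show "real (card (injections k n)) \<le> real n ^ k"
      by (simp add: card_PiE flip: of_nat_power)
  qed (use x in auto)
  also have "real n ^ k * x ^ k = 1"
    using n by (simp add: x_def power_mult_distrib[symmetric])
  finally show ?thesis unfolding x_def by simp
qed

section \<open>Unions of copies of a strongly balanced graph\<close>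

text \<open>The new copy shares with the old union at most the edges inside the common vertex set
  \<open>W\<close>. Strong balance bounds their number by
  \<open>card E * (card W - 1) / (k - 1)\<close>, exactly the loss that the bound tolerates when
  only \<open>k - card W\<close> vertices are new.\<close>

lemma glued_copy_edge_bound:
  fixes E :: "nat set set" and U :: "nat set" and D :: "nat set set"
  assumes k: "2 \<le> k" and E: "simple_graph {1..k} E" and bal: "strongly_balanced {1..k} E"
    and \<gamma>: "inj_on \<gamma> {1..k}"
    and U: "finite U" "\<And>e. e \<in> D \<Longrightarrow> e \<subseteq> U" and meet: "U \<inter> \<gamma> ` {1..k} \<noteq> {}"
    and D: "card E * (card U - 1) \<le> (k - 1) * card D"
  shows "card (U \<union> \<gamma> ` {1..k}) \<le> card U + (k - 1)"
    and "card E * (card (U \<union> \<gamma> ` {1..k}) - 1) \<le> (k - 1) * card (D \<union> (`) \<gamma> ` E)"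
proof -
  define W where "W = {u \<in> {1..k}. \<gamma> u \<in> U}"
  define E' where "E' = {e \<in> E. e \<subseteq> W}"
  have EK: "E \<subseteq> Pow {1..k}" using E by (auto simp: simple_graph_def)
  have finE: "finite E" by (rule finite_subset[OF EK]) simp
  have finD: "finite D" using U by (intro finite_subset[of D "Pow U"]) auto
  have W: "finite W" "W \<subseteq> {1..k}" by (auto simp: W_def)
  have UW: "U \<inter> \<gamma> ` {1..k} = \<gamma> ` W" by (auto simp: W_def)
  have cardW: "card (\<gamma> ` W) = card W" using W \<gamma> by (metis card_image inj_on_subset)
  have W1: "1 \<le> card W" using meet UW W by (auto simp: Suc_le_eq card_gt_0_iff)
  have WU: "card W \<le> card U" using UW U(1) cardW by (metis Int_lower1 card_mono)
  have Wk: "card W \<le> k" using card_mono[OF _ W(2)] by simp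
  have cardK: "card (\<gamma> ` {1..k}) = k" using \<gamma> by (simp add: card_image)
  have cardU: "card (U \<union> \<gamma> ` {1..k}) + card W = card U + k"
    using card_Un_Int[of U "\<gamma> ` {1..k}"] U(1) cardK UW cardW by simp
  then show "card (U \<union> \<gamma> ` {1..k}) \<le> card U + (k - 1)" using W1 k by linarith
  have E': "(k - 1) * card E' \<le> card E * (card W - 1)"
  proof (cases "2 \<le> card W")
    case True
    have "subgraph W E' {1..k} E"
      using W E by (auto simp: subgraph_def simple_graph_def E'_def)
    then have "real (card E') / (real (card W) - 1) \<le> real (card E) / (real k - 1)"
      using bal True unfolding strongly_balanced_def by (metis card_atLeastAtMost diff_Suc_1)
    then have "real (card E') * (real k - 1) \<le> real (card E) * (real (card W) - 1)"
      using True k by (simp add: divide_simps mult_ac)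
    then have "real ((k - 1) * card E') \<le> real (card E * (card W - 1))"
      using True k by (simp add: of_nat_diff mult_ac)
    then show ?thesis by (simp only: of_nat_le_iff)
  next
    \<comment> \<open>Strong balance is silent about fewer than two vertices, but then no edge fits
      into \<open>W\<close>.\<close>
    case False
    have "E' = {}"
    proof (rule ccontr)
      assume "E' \<noteq> {}"
      then obtain e where e: "e \<in> E" "e \<subseteq> W" by (auto simp: E'_def)
      then have "card e = 2" using E by (simp add: simple_graph_def)
      moreover have "card e \<le> card W" by (rule card_mono[OF W(1) e(2)])
      ultimately show False using False by simp
    qed
    then show ?thesis by simp
  qed
  have injE: "inj_on ((`) \<gamma>) E"
    using inj_on_image_Pow[OF \<gamma>] EK by (rule inj_on_subset)
  have "D \<inter> (`) \<gamma> ` E \<subseteq> (`) \<gamma> ` E'"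
  proof
    fix d assume "d \<in> D \<inter> (`) \<gamma> ` E"
    then obtain e where e: "e \<in> E" "d = \<gamma> ` e" "d \<in> D" by auto
    then have "e \<subseteq> W" using U(2) EK by (fastforce simp: W_def)
    then show "d \<in> (`) \<gamma> ` E'" using e by (auto simp: E'_def)
  qed
  then have "card (D \<inter> (`) \<gamma> ` E) \<le> card E'"
    using finE by (intro order_trans[OF card_mono card_image_le]) (auto simp: E'_def)
  moreover have "card D + card E = card (D \<union> (`) \<gamma> ` E) + card (D \<inter> (`) \<gamma> ` E)"
    using card_Un_Int[of D "(`) \<gamma> ` E"] finD finE card_image[OF injE] by simp
  ultimately have DE: "card D + card E \<le> card (D \<union> (`) \<gamma> ` E) + card E'" by simp
  \<comment> \<open>The bounds \<open>1 \<le> card W \<le> card U\<close> make the truncated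
    subtractions exact.\<close>
  have "card (U \<union> \<gamma> ` {1..k}) - 1 = (card U - 1) + (k - 1) - (card W - 1)"
    using cardU W1 WU k by linarith
  then have "card E * (card (U \<union> \<gamma> ` {1..k}) - 1) + card E * (card W - 1) =
      card E * (card U - 1) + card E * (k - 1)"
    using W1 WU Wk k by (simp flip: add_mult_distrib2)
  also have "\<dots> \<le> (k - 1) * card D + (k - 1) * card E"
    using D by simp
  also have "\<dots> \<le> (k - 1) * (card (D \<union> (`) \<gamma> ` E) + card E')"
    using mult_le_mono2[OF DE, of "k - 1"] by (simp add: add_mult_distrib2)
  also have "\<dots> \<le> (k - 1) * card (D \<union> (`) \<gamma> ` E) + card E * (card W - 1)"
    using E' by (simp add: add_mult_distrib2)
  finally show "card E * (card (U \<union> \<gamma> ` {1..k}) - 1) \<le> (k - 1) * card (D \<union> (`) \<gamma> ` E)"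
    by simp
qed

text \<open>Copies are glued one at a time to a maximal family that still satisfies the edge bound; if it is
  not everything, then no further copy meets it and it splits off.\<close>

lemma union_of_copies_dichotomy:
  fixes \<beta> :: "nat \<Rightarrow> nat \<Rightarrow> nat"
  assumes k: "2 \<le> k" and E: "simple_graph {1..k} E" and bal: "strongly_balanced {1..k} E"
    and j: "0 < j" and \<beta>: "\<And>i. i < j \<Longrightarrow> inj_on (\<beta> i) {1..k}"
  shows "(\<exists>A. A \<noteq> {} \<and> A \<subset> {..<j} \<and>
        (\<Union>i\<in>A. \<beta> i ` {1..k}) \<inter> (\<Union>i\<in>{..<j} - A. \<beta> i ` {1..k}) = {}) \<or>
      card (\<Union>i<j. \<beta> i ` {1..k}) \<le> 1 + (k - 1) * j \<and>
      card E * (card (\<Union>i<j. \<beta> i ` {1..k}) - 1) \<le> (k - 1) * card (\<Union>i<j. (`) (\<beta> i) ` E)"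
proof -
  define V where "V = (\<lambda>S. \<Union>i\<in>S. \<beta> i ` {1..k})"
  define D where "D = (\<lambda>S. \<Union>i\<in>S. (`) (\<beta> i) ` E)"
  define \<S> where "\<S> = {S. S \<noteq> {} \<and> S \<subseteq> {..<j} \<and> card (V S) \<le> 1 + (k - 1) * card S \<and>
      card E * (card (V S) - 1) \<le> (k - 1) * card (D S)}"
  \<comment> \<open>A single copy attains the edge bound with equality, which starts the
    gluing.\<close>
  have "{0} \<in> \<S>"
  proof -
    have "inj_on ((`) (\<beta> 0)) E"
      using inj_on_image_Pow[OF \<beta>[OF j]] by (rule inj_on_subset) (use E in \<open>auto simp: simple_graph_def\<close>)
    then have "card (D {0}) = card E" by (simp add: D_def card_image)
    moreover have "card (V {0}) = k" using \<beta>[OF j] by (simp add: V_def card_image)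
    ultimately show ?thesis using j k by (simp add: \<S>_def mult.commute)
  qed
  moreover have "finite \<S>" by (rule finite_subset[of _ "Pow {..<j}"]) (auto simp: \<S>_def)
  ultimately obtain S where S: "S \<in> \<S>" and max: "\<And>T. T \<in> \<S> \<Longrightarrow> S \<subseteq> T \<Longrightarrow> S = T"
    using finite_has_maximal[of \<S>] by auto
  have Sj: "S \<noteq> {}" "S \<subseteq> {..<j}" "finite S"
    using S finite_subset[of S "{..<j}"] by (auto simp: \<S>_def)
  have disj: "V S \<inter> \<beta> i ` {1..k} = {}" if i: "i \<in> {..<j} - S" for i
  proof (rule ccontr)
    assume meet: "V S \<inter> \<beta> i ` {1..k} \<noteq> {}"
    have fin: "finite (V S)" using Sj by (simp add: V_def)
    have sub: "e \<subseteq> V S" if "e \<in> D S" for e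
      using that E by (fastforce simp: V_def D_def simple_graph_def)
    have VD: "V (insert i S) = V S \<union> \<beta> i ` {1..k}" "D (insert i S) = D S \<union> (`) (\<beta> i) ` E"
      by (auto simp: V_def D_def)
    have inj: "inj_on (\<beta> i) {1..k}" using i \<beta> by simp
    have "card E * (card (V S) - 1) \<le> (k - 1) * card (D S)" using S by (simp add: \<S>_def)
    note glue = glued_copy_edge_bound[OF k E bal inj fin sub meet this]
    have "card (V (insert i S)) \<le> 1 + (k - 1) * card (insert i S)"
      using glue(1) S Sj i by (simp add: VD \<S>_def)
    then have "insert i S \<in> \<S>"
      using glue(2) i Sj by (simp add: \<S>_def VD)
    then show False using max[of "insert i S"] i by auto
  qed
  show ?thesis
  proof (cases "S = {..<j}")
    case True
    then show ?thesis using S by (simp add: \<S>_def V_def D_def)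
  next
    case False
    then have "S \<subset> {..<j}" using Sj by auto
    moreover have "(\<Union>i\<in>S. \<beta> i ` {1..k}) \<inter> (\<Union>i\<in>{..<j} - S. \<beta> i ` {1..k}) = {}"
      using disj unfolding V_def by blast
    ultimately show ?thesis using Sj(1) by blast
  qed
qed

section \<open>Edge probabilities\<close>

text \<open>Translates unordered edges into the enumeration by \<open>i < j\<close> used in
  \<open>edges_cond_indep\<close>.\<close>

definition ordered_pairs :: "nat set set \<Rightarrow> (nat \<times> nat) set" where
  "ordered_pairs D = {(i, j). i < j \<and> {i, j} \<in> D}"

lemma bij_betw_ordered_pairs:
  assumes "\<And>e. e \<in> D \<Longrightarrow> card e = 2"
  shows "bij_betw (\<lambda>(i, j). {i, j}) (ordered_pairs D) D"
proof -
  have "inj_on (\<lambda>(i, j). {i, j}) (ordered_pairs D)"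
    by (auto simp: inj_on_def ordered_pairs_def doubleton_eq_iff)
  moreover have "(\<lambda>(i, j). {i, j}) ` ordered_pairs D = D"
  proof (intro subset_antisym subsetI)
    fix e assume e: "e \<in> D"
    then obtain a b where ab: "e = {a, b}" "a \<noteq> b" using assms by (meson card_2_iff)
    have "(min a b, max a b) \<in> ordered_pairs D" and "e = {min a b, max a b}"
      using ab e by (auto simp: ordered_pairs_def min_def max_def insert_commute)
    then show "e \<in> (\<lambda>(i, j). {i, j}) ` ordered_pairs D" by force
  qed (auto simp: ordered_pairs_def)
  ultimately show ?thesis by (simp add: bij_betw_def)
qed

definition vertex_pairs :: "nat \<Rightarrow> nat set set" where
  "vertex_pairs n = {e. e \<subseteq> {1..n} \<and> card e = 2}"

lemma finite_vertex_pairs: "finite (vertex_pairs n)"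
  unfolding vertex_pairs_def by (rule finite_subset[of _ "Pow {1..n}"]) auto

lemma simple_graph_iff_vertex_pairs: "simple_graph {1..n} B \<longleftrightarrow> B \<subseteq> vertex_pairs n"
  by (auto simp: simple_graph_def vertex_pairs_def)

context random_connection_model
begin

section \<open>The law of the random graph\<close>

lemma edges_subset: "\<omega> \<in> space M \<Longrightarrow> A \<omega> \<subseteq> vertex_pairs n"
  using edges_graph unfolding simple_graph_iff_vertex_pairs by blast

lemma edge_event_measurable:
  assumes "e \<in> vertex_pairs n"
  shows "{\<omega> \<in> space M. e \<in> A \<omega>} \<in> sets M"
proof -
  obtain a b where ab: "e = {a, b}" "a \<noteq> b" using assms by (auto simp: vertex_pairs_def card_2_iff)
  then have *: "a \<in> {1..n}" "b \<in> {1..n}" using assms by (auto simp: vertex_pairs_def)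
  consider "a < b" | "b < a" using ab by linarith
  then show ?thesis
    using edges_measurable[of a b] edges_measurable[of b a] * ab by cases (auto simp: insert_commute)
qed

lemma graph_event_measurable:
  assumes "B \<subseteq> vertex_pairs n"
  shows "{\<omega> \<in> space M. A \<omega> = B} \<in> sets M"
proof -
  have "{\<omega> \<in> space M. A \<omega> = B} = {\<omega> \<in> space M. \<forall>e\<in>vertex_pairs n. e \<in> A \<omega> \<longleftrightarrow> e \<in> B}"
    using edges_subset assms by blast
  also have "\<dots> \<in> sets M"
  proof (rule sets.sets_Collect_finite_All[OF _ finite_vertex_pairs])
    fix e assume e: "e \<in> vertex_pairs n"
    show "{\<omega> \<in> space M. e \<in> A \<omega> \<longleftrightarrow> e \<in> B} \<in> sets M"
      using edge_event_measurable[OF e] sets.sets_Collect_neg[OF edge_event_measurable[OF e]]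
      by (cases "e \<in> B") auto
  qed
  finally show ?thesis .
qed

text \<open>The graph takes finitely many values, so the moment generating function is the finite
  exponential sum that Good's formula is stated for.\<close>

lemma integral_graph_function:
  fixes f :: "nat set set \<Rightarrow> real"
  shows "(\<integral>\<omega>. f (A \<omega>) \<partial>M) = (\<Sum>B\<in>Pow (vertex_pairs n). prob {\<omega> \<in> space M. A \<omega> = B} * f B)"
proof -
  have "(\<integral>\<omega>. f (A \<omega>) \<partial>M) =
      (\<integral>\<omega>. (\<Sum>B\<in>Pow (vertex_pairs n). f B * indicator {\<omega> \<in> space M. A \<omega> = B} \<omega>) \<partial>M)"
  proof (intro Bochner_Integration.integral_cong refl)
    fix \<omega> assume \<omega>: "\<omega> \<in> space M"
    have "(\<Sum>B\<in>Pow (vertex_pairs n). f B * indicator {\<omega> \<in> space M. A \<omega> = B} \<omega>) =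
        (\<Sum>B\<in>{A \<omega>}. f B * indicator {\<omega> \<in> space M. A \<omega> = B} \<omega>)"
      using edges_subset[OF \<omega>] finite_vertex_pairs by (intro sum.mono_neutral_right) (auto simp: indicator_def split: if_splits)
    then show "f (A \<omega>) = (\<Sum>B\<in>Pow (vertex_pairs n). f B * indicator {\<omega> \<in> space M. A \<omega> = B} \<omega>)"
      using \<omega> by simp
  qed
  also have "\<dots> = (\<Sum>B\<in>Pow (vertex_pairs n). \<integral>\<omega>. f B * indicator {\<omega> \<in> space M. A \<omega> = B} \<omega> \<partial>M)"
    using graph_event_measurable
    by (intro Bochner_Integration.integral_sum integrable_mult_right integrable_real_indicator)
      (auto simp: emeasure_eq_measure)
  also have "\<dots> = (\<Sum>B\<in>Pow (vertex_pairs n). prob {\<omega> \<in> space M. A \<omega> = B} * f B)"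
    using graph_event_measurable by (intro sum.cong refl) (simp add: Int_def conj_commute cong: conj_cong)
  finally show ?thesis .
qed

definition graph_prob :: "nat set set \<Rightarrow> real" where
  "graph_prob B = prob {\<omega> \<in> space M. A \<omega> = B}"

lemma sum_graph_prob: "sum graph_prob (Pow (vertex_pairs n)) = 1"
  using integral_graph_function[of "\<lambda>_. 1"] by (simp add: graph_prob_def prob_space)

text \<open>At the sampled points this is the conditional probability that all pairs in
  \<open>D\<close> are connected.\<close>

definition edge_weight :: "nat set set \<Rightarrow> (nat \<Rightarrow> real ^ 'd) \<Rightarrow> real" where
  "edge_weight D x = (\<Prod>(i, j)\<in>ordered_pairs D. p * H (x i) (x j))"

lemma edge_weight_nonneg: "0 \<le> edge_weight D x"
  unfolding edge_weight_def using p_range H_range by (intro prod_nonneg) auto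

lemma edge_weight_le:
  assumes "D \<subseteq> vertex_pairs n"
  shows "edge_weight D x \<le> p ^ card D"
proof -
  have "card e = 2" if "e \<in> D" for e using assms that by (auto simp: vertex_pairs_def)
  then have card: "card (ordered_pairs D) = card D"
    by (intro bij_betw_same_card[OF bij_betw_ordered_pairs])
  have "edge_weight D x \<le> (\<Prod>(i, j)\<in>ordered_pairs D. p)"
    unfolding edge_weight_def using p_range H_range
    by (intro prod_mono) (auto intro!: mult_left_le)
  then show ?thesis by (simp add: card case_prod_beta)
qed

lemma edge_weight_restrict:
  assumes "\<Union>D \<subseteq> U"
  shows "edge_weight D (restrict x U) = edge_weight D x"
proof -
  have "i \<in> U" "j \<in> U" if "(i, j) \<in> ordered_pairs D" for i j
    using assms that by (auto simp: ordered_pairs_def)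
  then show ?thesis
    unfolding edge_weight_def by (intro prod.cong refl) auto
qed

lemma ordered_pairs_subset:
  "D \<subseteq> vertex_pairs n \<Longrightarrow> ordered_pairs D \<subseteq> {(i, j). 1 \<le> i \<and> i < j \<and> j \<le> n}"
  by (auto simp: ordered_pairs_def vertex_pairs_def)

lemma edge_weight_Un:
  assumes D: "D1 \<subseteq> vertex_pairs n" "D2 \<subseteq> vertex_pairs n" and disj: "\<Union>D1 \<inter> \<Union>D2 = {}"
  shows "edge_weight (D1 \<union> D2) x = edge_weight D1 x * edge_weight D2 x"
proof -
  have fin: "finite (ordered_pairs D)" if "D \<subseteq> vertex_pairs n" for D
    by (rule finite_subset[of _ "{1..n} \<times> {1..n}"]) (use ordered_pairs_subset[OF that] in auto)
  have "ordered_pairs (D1 \<union> D2) = ordered_pairs D1 \<union> ordered_pairs D2"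
    by (auto simp: ordered_pairs_def)
  moreover have "ordered_pairs D1 \<inter> ordered_pairs D2 = {}"
    using disj by (fastforce simp: ordered_pairs_def)
  ultimately show ?thesis
    unfolding edge_weight_def using D by (simp add: prod.union_disjoint fin)
qed

lemma edge_weight_measurable:
  assumes "\<Union>D \<subseteq> U"
  shows "edge_weight D \<in> borel_measurable (Pi\<^sub>M U (\<lambda>_. borel))"
  unfolding edge_weight_def[abs_def]
proof (rule borel_measurable_prod, clarify)
  fix i j assume "(i, j) \<in> ordered_pairs D"
  then have ij: "i \<in> U" "j \<in> U" using assms by (auto simp: ordered_pairs_def)
  have "(\<lambda>x. (x i, x j)) \<in> Pi\<^sub>M U (\<lambda>_. borel) \<rightarrow>\<^sub>M borel \<Otimes>\<^sub>M (borel :: (real ^ 'd) measure)"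
    using ij by (intro measurable_Pair measurable_component_singleton)
  from measurable_compose[OF this H_measurable]
  have "(\<lambda>x. H (x i) (x j)) \<in> borel_measurable (Pi\<^sub>M U (\<lambda>_. borel))" by simp
  then show "(\<lambda>x. p * H (x i) (x j)) \<in> borel_measurable (Pi\<^sub>M U (\<lambda>_. borel))"
    by (intro borel_measurable_times) auto
qed

lemma point_measurable: "i \<in> {1..n} \<Longrightarrow> X i \<in> borel_measurable M"
  using points_indep by (auto simp: indep_vars_def)

lemma points_restrict_measurable:
  assumes "U \<subseteq> {1..n}"
  shows "(\<lambda>\<omega>. \<lambda>i\<in>U. X i \<omega>) \<in> M \<rightarrow>\<^sub>M Pi\<^sub>M U (\<lambda>_. borel)"
  using assms point_measurable by (intro measurable_restrict) auto

lemma edge_weight_points_measurable: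
  assumes "D \<subseteq> vertex_pairs n"
  shows "(\<lambda>\<omega>. edge_weight D (\<lambda>i. X i \<omega>)) \<in> borel_measurable M"
proof -
  have U: "\<Union>D \<subseteq> {1..n}" using assms by (auto simp: vertex_pairs_def)
  have "(\<lambda>\<omega>. edge_weight D (\<lambda>i\<in>{1..n}. X i \<omega>)) \<in> borel_measurable M"
    by (rule measurable_compose[OF points_restrict_measurable edge_weight_measurable[OF U]]) simp
  then show ?thesis by (simp only: edge_weight_restrict[OF U])
qed

lemma edge_weight_points_integrable:
  assumes "D \<subseteq> vertex_pairs n"
  shows "integrable M (\<lambda>\<omega>. edge_weight D (\<lambda>i. X i \<omega>))"
  using edge_weight_points_measurable[OF assms] edge_weight_le[OF assms] edge_weight_nonneg
  by (intro integrable_const_bound[where B = "p ^ card D"]) auto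

text \<open>The tower property applied to \<open>edges_cond_indep\<close>; it requires that the
  sigma-algebra generated by the points be a subalgebra of \<open>M\<close>.\<close>

lemma prob_contains_eq_integral:
  assumes D: "D \<subseteq> vertex_pairs n"
  shows "prob {\<omega> \<in> space M. D \<subseteq> A \<omega>} = (\<integral>\<omega>. edge_weight D (\<lambda>i. X i \<omega>) \<partial>M)"
proof -
  define F where "F = vimage_algebra (space M) (\<lambda>\<omega>. \<lambda>i\<in>{1..n}. X i \<omega>) (Pi\<^sub>M {1..n} (\<lambda>_. borel :: (real ^ 'd) measure))"
  define ev where "ev = {\<omega> \<in> space M. \<forall>(i, j)\<in>ordered_pairs D. {i, j} \<in> A \<omega>}"
  have "subalgebra M F"
  proof -
    note meas = points_restrict_measurable[OF order_refl]
    have sp: "(\<lambda>\<omega>. \<lambda>i\<in>{1..n}. X i \<omega>) \<in> space M \<rightarrow> space (Pi\<^sub>M {1..n} (\<lambda>_. borel))"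
      using measurable_space[OF meas] by blast
    have "sets F \<subseteq> sets M"
      unfolding F_def sets_vimage_algebra2[OF sp] using measurable_sets[OF meas] by blast
    then show ?thesis by (simp add: subalgebra_def F_def)
  qed
  then interpret F: finite_measure_subalgebra M F by unfold_locales
  have "bij_betw (\<lambda>(i, j). {i, j}) (ordered_pairs D) D"
    using D by (intro bij_betw_ordered_pairs) (auto simp: vertex_pairs_def)
  then have img: "(\<lambda>(i, j). {i, j}) ` ordered_pairs D = D" by (simp add: bij_betw_def)
  have ev: "ev = {\<omega> \<in> space M. D \<subseteq> A \<omega>}"
    unfolding ev_def by (subst (2) img[symmetric]) auto
  have evM: "ev \<in> sets M"
  proof -
    have "{\<omega> \<in> space M. D \<subseteq> A \<omega>} = {\<omega> \<in> space M. \<forall>e\<in>D. e \<in> A \<omega>}" by auto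
    also have "\<dots> \<in> sets M"
      using D finite_subset[OF D finite_vertex_pairs] edge_event_measurable
      by (intro sets.sets_Collect_finite_All) auto
    finally show ?thesis by (simp add: ev)
  qed
  have "AE \<omega> in M. real_cond_exp M F (indicator ev) \<omega> = edge_weight D (\<lambda>i. X i \<omega>)"
    unfolding F_def ev_def edge_weight_def
    by (rule edges_cond_indep[OF ordered_pairs_subset[OF D]])
  then have "(\<integral>\<omega>. edge_weight D (\<lambda>i. X i \<omega>) \<partial>M) = (\<integral>\<omega>. real_cond_exp M F (indicator ev) \<omega> \<partial>M)"
    using edge_weight_points_measurable[OF D]
    by (intro integral_cong_AE) auto
  also have "\<dots> = (\<integral>\<omega>. indicator ev \<omega> \<partial>M)"
    using evM by (intro F.real_cond_exp_int) (auto simp: emeasure_eq_measure)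
  also have "\<dots> = prob ev" using evM by simp
  finally show ?thesis by (simp add: ev)
qed

lemma containment_weight_eq:
  "containment_weight (Pow (vertex_pairs n)) graph_prob D = prob {\<omega> \<in> space M. D \<subseteq> A \<omega>}"
proof -
  have "prob {\<omega> \<in> space M. D \<subseteq> A \<omega>} = (\<integral>\<omega>. indicator {\<omega> \<in> space M. D \<subseteq> A \<omega>} \<omega> \<partial>M)"
    by (simp add: Int_def conj_commute cong: conj_cong)
  also have "\<dots> = (\<integral>\<omega>. of_bool (D \<subseteq> A \<omega>) \<partial>M)"
    by (intro Bochner_Integration.integral_cong refl) (auto simp: indicator_def)
  also have "\<dots> = containment_weight (Pow (vertex_pairs n)) graph_prob D"
    unfolding containment_weight_def graph_prob_def
    by (rule integral_graph_function[of "\<lambda>B. of_bool (D \<subseteq> B)"])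
  finally show ?thesis ..
qed

lemma containment_weight_nonneg: "0 \<le> containment_weight (Pow (vertex_pairs n)) graph_prob D"
  by (simp add: containment_weight_eq)

lemma containment_weight_le:
  assumes D: "D \<subseteq> vertex_pairs n"
  shows "containment_weight (Pow (vertex_pairs n)) graph_prob D \<le> p ^ card D"
proof -
  have "(\<integral>\<omega>. edge_weight D (\<lambda>i. X i \<omega>) \<partial>M) \<le> (\<integral>\<omega>. p ^ card D \<partial>M)"
    by (intro integral_mono edge_weight_points_integrable D edge_weight_le) simp
  then show ?thesis
    by (simp add: containment_weight_eq prob_contains_eq_integral[OF D] prob_space)
qed

text \<open>The two weights are functions of disjoint groups of independent points, so the
  expectation of their product factorises. Vertex-disjointness matters: edges with a common endpoint
  can be dependent through that point.\<close>

lemma containment_weight_Un: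
  assumes D: "D1 \<subseteq> vertex_pairs n" "D2 \<subseteq> vertex_pairs n" and disj: "\<Union>D1 \<inter> \<Union>D2 = {}"
  shows "containment_weight (Pow (vertex_pairs n)) graph_prob (D1 \<union> D2) =
    containment_weight (Pow (vertex_pairs n)) graph_prob D1 *
    containment_weight (Pow (vertex_pairs n)) graph_prob D2"
proof -
  have U: "\<Union>D1 \<subseteq> {1..n}" "\<Union>D2 \<subseteq> {1..n}" using D by (auto simp: vertex_pairs_def)
  have comp: "edge_weight D \<circ> (\<lambda>\<omega>. restrict (\<lambda>i. X i \<omega>) (\<Union>D)) = (\<lambda>\<omega>. edge_weight D (\<lambda>i. X i \<omega>))" for D
    by (simp add: fun_eq_iff edge_weight_restrict)
  have "indep_var borel (edge_weight D1 \<circ> (\<lambda>\<omega>. restrict (\<lambda>i. X i \<omega>) (\<Union>D1)))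
      borel (edge_weight D2 \<circ> (\<lambda>\<omega>. restrict (\<lambda>i. X i \<omega>) (\<Union>D2)))"
    by (intro indep_var_compose[OF indep_var_restrict[OF points_indep disj U]] edge_weight_measurable order_refl)
  then have "indep_var borel (\<lambda>\<omega>. edge_weight D1 (\<lambda>i. X i \<omega>)) borel (\<lambda>\<omega>. edge_weight D2 (\<lambda>i. X i \<omega>))"
    by (simp only: comp)
  from indep_var_lebesgue_integral[OF this edge_weight_points_integrable[OF D(1)] edge_weight_points_integrable[OF D(2)]]
  show ?thesis
    unfolding containment_weight_eq edge_weight_Un[OF D disj]
      prob_contains_eq_integral[OF Un_least[OF D]] prob_contains_eq_integral[OF D(1)]
      prob_contains_eq_integral[OF D(2)] .
qed

end

section \<open>The cumulant bound\<close>

context random_connection_model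
begin

text \<open>Serves both regimes: \<open>C\<close> dominates the powers of \<open>q\<close> over all
  vertex numbers \<open>v\<close> possible for a tuple that does not split.\<close>

lemma cumulant_subgraph_count_le:
  fixes k :: nat and E :: "nat set set" and C :: real
  defines "q \<equiv> real n * p powr (real (card E) / (real k - 1))"
  assumes k: "2 \<le> k" and E: "simple_graph {1..k} E" and bal: "strongly_balanced {1..k} E"
    and n: "1 \<le> n" and j: "2 \<le> j"
    and C: "\<And>v. k \<le> v \<Longrightarrow> v \<le> 1 + (k - 1) * j \<Longrightarrow> q ^ (v - 1) \<le> C"
  shows "\<bar>cumulant M j (\<lambda>\<omega>. subgraph_count k E n (A \<omega>))\<bar>
    \<le> real j ^ (j - 1) * fact j ^ k * (fact k ^ (j - 1) / real (card (automorphisms {1..k} E)) ^ j)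
      * (real n * C)"
proof -
  define c where "c = 1 / real (card (automorphisms {1..k} E))"
  define D where "D = (\<lambda>\<gamma>::nat \<Rightarrow> nat. (`) \<gamma> ` E)"
  define N where "N = (\<lambda>B. c * (\<Sum>\<gamma>\<in>injections k n. of_bool (D \<gamma> \<subseteq> B)))"
  define G where "G = Pow (vertex_pairs n)"
  define V where "V = (\<lambda>\<beta>::nat \<Rightarrow> nat \<Rightarrow> nat. \<Union>i<j. \<beta> i ` {1..k})"
  define u where "u = (\<lambda>\<beta>. real n * (1 / real n) ^ card (V \<beta>) * C)"
  define r where "r = p powr (real (card E) / (real k - 1))"
  have r: "0 < r" using p_range by (simp add: r_def)
  have qr: "q = real n * r" by (simp add: q_def r_def)
  have finE: "finite E" using E finite_subset[of E "Pow {1..k}"] by (auto simp: simple_graph_def)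
  have "k \<le> 1 + (k - 1) * j"
    using k j mult_le_mono2[of 1 j "k - 1"] by linarith
  then have "q ^ (k - 1) \<le> C" using C[of k] by simp
  moreover have "0 \<le> q ^ (k - 1)" using r by (simp add: qr)
  ultimately have C0: "0 \<le> C" by linarith
  have DV: "D \<gamma> \<subseteq> vertex_pairs n" "\<Union>(D \<gamma>) \<subseteq> \<gamma> ` {1..k}" if "\<gamma> \<in> injections k n" for \<gamma>
  proof -
    have \<gamma>: "\<gamma> ` {1..k} \<subseteq> {1..n}" "inj_on \<gamma> {1..k}"
      using that by (auto simp: injections_def)
    show *: "\<Union>(D \<gamma>) \<subseteq> \<gamma> ` {1..k}"
      using E unfolding D_def simple_graph_def by blast
    show "D \<gamma> \<subseteq> vertex_pairs n"
    proof
      fix d assume d: "d \<in> D \<gamma>"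
      then obtain e where e: "e \<in> E" "d = \<gamma> ` e" by (auto simp: D_def)
      then have "card d = 2"
        using E inj_on_subset[OF \<gamma>(2), of e] by (simp add: simple_graph_def card_image)
      moreover have "d \<subseteq> {1..n}" using d * \<gamma>(1) by blast
      ultimately show "d \<in> vertex_pairs n" by (simp add: vertex_pairs_def)
    qed
  qed
  have "subgraph_count k E n B = N B" for B
  proof -
    have "(\<Prod>e\<in>E. of_bool (\<gamma> ` e \<in> B)) = (of_bool (D \<gamma> \<subseteq> B) :: real)" for \<gamma>
    proof (cases "D \<gamma> \<subseteq> B")
      case True
      then show ?thesis by (auto simp: D_def intro!: prod.neutral)
    next
      case False
      then show ?thesis using finE by (auto simp: D_def prod_zero_iff)
    qed
    then show ?thesis by (simp add: subgraph_count_def N_def c_def injections_def)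
  qed
  then have "cumulant M j (\<lambda>\<omega>. subgraph_count k E n (A \<omega>)) =
      (deriv ^^ j) (\<lambda>t. ln (\<Sum>B\<in>G. graph_prob B * exp (t * N B))) 0"
    unfolding cumulant_def G_def graph_prob_def
    by (simp add: integral_graph_function[of "\<lambda>B. exp (_ * N B)"])
  also have "\<bar>\<dots>\<bar> \<le> c ^ j * real j ^ (j - 1) * (\<Sum>\<beta> \<in> {..<j} \<rightarrow>\<^sub>E injections k n. u \<beta>)"
  proof (rule cumulant_indicator_sum_bound[where D = D])
    show "finite G" by (simp add: G_def finite_vertex_pairs)
    show "finite (injections k n)" by (rule finite_injections)
    show "0 \<le> graph_prob B" for B by (simp add: graph_prob_def)
    show "sum graph_prob G = 1" unfolding G_def by (rule sum_graph_prob)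
    show "0 < j" using j by simp
    show "N B = c * (\<Sum>\<beta>\<in>injections k n. of_bool (D \<beta> \<subseteq> B))" for B by (simp add: N_def)
    show "0 \<le> c" by (simp add: c_def)
    show "0 \<le> u \<beta>" for \<beta> using C0 by (simp add: u_def)
    fix \<beta> assume "\<beta> \<in> {..<j} \<rightarrow>\<^sub>E injections k n"
    then have \<beta>: "\<beta> i \<in> injections k n" if "i < j" for i using that by auto
    have inj: "inj_on (\<beta> i) {1..k}" if "i < j" for i using \<beta>[OF that] by (simp add: injections_def)
    have Dsub: "(\<Union>i\<in>S. D (\<beta> i)) \<subseteq> vertex_pairs n" if "S \<subseteq> {..<j}" for S
      using DV(1)[OF \<beta>] that by (auto simp: subset_iff)
    have Vsub: "\<Union>(\<Union>i\<in>T. D (\<beta> i)) \<subseteq> (\<Union>i\<in>T'. \<beta> i ` {1..k})"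
      if "T \<subseteq> T'" "T' \<subseteq> {..<j}" for T T'
    proof
      fix x assume "x \<in> \<Union>(\<Union>i\<in>T. D (\<beta> i))"
      then obtain i where i: "i \<in> T" "x \<in> \<Union>(D (\<beta> i))" by blast
      then have "x \<in> \<beta> i ` {1..k}" using DV(2)[OF \<beta>, of i] that by blast
      then show "x \<in> (\<Union>i\<in>T'. \<beta> i ` {1..k})" using i that by blast
    qed
    have j0: "0 < j" using j by simp
    consider S0 where "S0 \<noteq> {}" "S0 \<subset> {..<j}"
        "(\<Union>i\<in>S0. \<beta> i ` {1..k}) \<inter> (\<Union>i\<in>{..<j} - S0. \<beta> i ` {1..k}) = {}"
      | "card (V \<beta>) \<le> 1 + (k - 1) * j"
        "card E * (card (V \<beta>) - 1) \<le> (k - 1) * card (\<Union>i<j. D (\<beta> i))"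
      using union_of_copies_dichotomy[OF k E bal j0, of \<beta>, OF inj] unfolding V_def D_def by blast
    then show "(\<exists>S0. S0 \<noteq> {} \<and> S0 \<subset> {..<j} \<and>
          (\<forall>S\<subseteq>{..<j}. containment_weight G graph_prob (\<Union>i\<in>S. D (\<beta> i)) =
            containment_weight G graph_prob (\<Union>i\<in>S \<inter> S0. D (\<beta> i)) *
            containment_weight G graph_prob (\<Union>i\<in>S - S0. D (\<beta> i)))) \<or>
        (\<forall>f\<in>{..<j} \<rightarrow>\<^sub>E {..<j}.
          (\<Prod>r<j. containment_weight G graph_prob (\<Union>i\<in>{i \<in> {..<j}. f i = r}. D (\<beta> i))) \<le> u \<beta>)"
    proof cases
      case S0: 1
      have "containment_weight G graph_prob (\<Union>i\<in>S. D (\<beta> i)) =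
          containment_weight G graph_prob (\<Union>i\<in>S \<inter> S0. D (\<beta> i)) *
          containment_weight G graph_prob (\<Union>i\<in>S - S0. D (\<beta> i))" if S: "S \<subseteq> {..<j}" for S
      proof -
        have "(\<Union>i\<in>S. D (\<beta> i)) = (\<Union>i\<in>S \<inter> S0. D (\<beta> i)) \<union> (\<Union>i\<in>S - S0. D (\<beta> i))" by blast
        moreover have "\<Union>(\<Union>i\<in>S \<inter> S0. D (\<beta> i)) \<inter> \<Union>(\<Union>i\<in>S - S0. D (\<beta> i)) = {}"
          using Vsub[of "S \<inter> S0" S0] Vsub[of "S - S0" "{..<j} - S0"] S S0(2,3) by blast
        moreover have "(\<Union>i\<in>S \<inter> S0. D (\<beta> i)) \<subseteq> vertex_pairs n" "(\<Union>i\<in>S - S0. D (\<beta> i)) \<subseteq> vertex_pairs n"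
          using S by (intro Dsub; blast)+
        ultimately show ?thesis
          unfolding G_def by (simp only: containment_weight_Un)
      qed
      then show ?thesis using S0 by blast
    next
      case 2
      let ?v = "card (V \<beta>)" and ?h = "card (\<Union>i<j. D (\<beta> i))"
      have "card (\<beta> 0 ` {1..k}) \<le> ?v"
        unfolding V_def using j0 by (intro card_mono) auto
      then have v: "k \<le> ?v" using inj[OF j0] by (simp add: card_image)
      \<comment> \<open>As \<open>p < 1\<close>, the lower bound on the number of edges becomes an
        upper bound on the probability.\<close>
      have "p ^ ?h \<le> r ^ (?v - 1)"
      proof -
        have "real (card E * (?v - 1)) \<le> real ((k - 1) * ?h)"
          using 2(2) by (simp only: of_nat_le_iff)
        then have "real (card E) / (real k - 1) * real (?v - 1) \<le> real ?h"
          using k by (simp add: field_simps of_nat_diff)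
        then have "p powr real ?h \<le> p powr (real (card E) / (real k - 1) * real (?v - 1))"
          using p_range by (intro powr_mono') auto
        also have "\<dots> = r ^ (?v - 1)"
          using r by (simp add: r_def powr_powr flip: powr_realpow)
        finally show ?thesis using p_range by (simp add: powr_realpow)
      qed
      also have "\<dots> = real n * (1 / real n) ^ ?v * q ^ (?v - 1)"
      proof -
        have "?v = Suc (?v - 1)" using v k by simp
        then have "(1 / real n) ^ ?v = 1 / real n * (1 / real n) ^ (?v - 1)" by (metis power_Suc)
        then show ?thesis using n by (simp add: qr power_mult_distrib power_one_over)
      qed
      also have "\<dots> \<le> u \<beta>"
        unfolding u_def using C[OF v 2(1)] by (intro mult_left_mono) auto
      finally have pu: "p ^ ?h \<le> u \<beta>" .
      have "(\<Prod>r<j. containment_weight G graph_prob (\<Union>i\<in>{i \<in> {..<j}. f i = r}. D (\<beta> i))) \<le> u \<beta>"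
        if f: "f \<in> {..<j} \<rightarrow>\<^sub>E {..<j}" for f
      proof -
        define U where "U = (\<lambda>r. \<Union>i\<in>{i \<in> {..<j}. f i = r}. D (\<beta> i))"
        have U: "U r \<subseteq> vertex_pairs n" for r unfolding U_def by (rule Dsub) auto
        have "(\<Union>i<j. D (\<beta> i)) \<subseteq> (\<Union>r<j. U r)"
        proof (rule UN_least)
          fix i assume "i \<in> {..<j}"
          then have "f i < j" "D (\<beta> i) \<subseteq> U (f i)" using f by (auto simp: U_def)
          then show "D (\<beta> i) \<subseteq> (\<Union>r<j. U r)" by blast
        qed
        \<comment> \<open>Different classes may share edges, so their sizes add up to at least
          \<open>?h\<close>; repeated edges only make the product smaller.\<close>
        then have "?h \<le> card (\<Union>r<j. U r)"
          using finite_subset[OF U finite_vertex_pairs] by (intro card_mono) auto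
        also have "\<dots> \<le> (\<Sum>r<j. card (U r))" by (rule card_UN_le) simp
        finally have h: "?h \<le> (\<Sum>r<j. card (U r))" .
        have "(\<Prod>r<j. containment_weight G graph_prob (U r)) \<le> (\<Prod>r<j. p ^ card (U r))"
          unfolding G_def by (intro prod_mono conjI containment_weight_nonneg containment_weight_le U)
        also have "\<dots> = p ^ (\<Sum>r<j. card (U r))" by (simp add: power_sum)
        also have "\<dots> \<le> p ^ ?h" using h p_range by (intro power_decreasing) auto
        finally show ?thesis using pu by (simp add: U_def)
      qed
      then show ?thesis by blast
    qed
  qed
  also have "(\<Sum>\<beta> \<in> {..<j} \<rightarrow>\<^sub>E injections k n. u \<beta>) =
      real n * C * (\<Sum>\<beta> \<in> {..<j} \<rightarrow>\<^sub>E injections k n. (1 / real n) ^ card (V \<beta>))"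
    by (simp add: u_def sum_distrib_left mult_ac)
  also have "c ^ j * real j ^ (j - 1) * \<dots> \<le>
      c ^ j * real j ^ (j - 1) * (real n * C * (fact j ^ k * fact k ^ (j - 1)))"
  proof -
    have "(\<Sum>\<beta> \<in> {..<j} \<rightarrow>\<^sub>E injections k n. (1 / real n) ^ card (V \<beta>)) \<le> fact j ^ k * fact k ^ (j - 1)"
      using sum_injection_tuples_le[OF n k, of "j - 1"] j by (simp add: V_def)
    then show ?thesis using C0 by (intro mult_left_mono) (auto simp: c_def)
  qed
  also have "\<dots> = real j ^ (j - 1) * fact j ^ k *
      (fact k ^ (j - 1) / real (card (automorphisms {1..k} E)) ^ j) * (real n * C)"
    by (simp add: c_def power_one_over)
  finally show ?thesis .
qed

end

section \<open>The two regimes of the connection probability\<close>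

lemma connected_graph_edges_nonempty:
  assumes "2 \<le> k" "connected_graph {1..k} E"
  shows "E \<noteq> {}"
proof
  assume "E = {}"
  moreover have "(1, 2) \<in> {(x, y). {x, y} \<in> E}\<^sup>*"
    using assms by (auto simp: connected_graph_def)
  ultimately show False by simp
qed

lemma much_less_imp_eventually_less:
  assumes "f \<lless> g"
  shows "\<forall>\<^sub>F n in sequentially. f n < g n"
proof -
  have "\<forall>\<^sub>F n in sequentially. f n / g n < 1"
    using assms unfolding much_less_def by (intro order_tendstoD(2)[where y = 0]) auto
  then show ?thesis
    using eventually_ge_at_top[of 1]
  proof eventually_elim
    case (elim n)
    then have "0 < g n" using assms by (auto simp: much_less_def)
    then show ?case using elim by (simp add: field_simps)
  qed
qed

theorem theorem7p5:
  fixes k :: nat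
    and E :: "nat set set"
    and \<mu> :: "(real ^ 'd) measure"
    and H :: "real ^ 'd \<Rightarrow> real ^ 'd \<Rightarrow> real"
    and p :: "nat \<Rightarrow> real"
    and M :: "nat \<Rightarrow> 'w measure"
    and X :: "nat \<Rightarrow> nat \<Rightarrow> 'w \<Rightarrow> real ^ 'd"
    and A :: "nat \<Rightarrow> 'w \<Rightarrow> nat set set"
  assumes "2 \<le> k"
    and "simple_graph {1..k} E"
    and "connected_graph {1..k} E"
    and "strongly_balanced {1..k} E"
    and "\<And>n. 1 \<le> n \<Longrightarrow> random_connection_model (M n) n \<mu> H (p n) (X n) (A n)"
  shows
    "((\<lambda>n. real n powr (- ((real k - 1) / real (card E)))) \<lless> p \<longrightarrow>
       (\<forall>\<^sub>F n in sequentially. \<forall>j\<ge>2.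
          \<bar>cumulant (M n) j (\<lambda>\<omega>. subgraph_count k E n (A n \<omega>))\<bar>
          \<le> real j ^ (j - 1) * fact j ^ k
            * (fact k ^ (j - 1) / real (card (automorphisms {1..k} E)) ^ j)
            * real n ^ (1 + (k - 1) * j) * p n ^ (j * card E))) \<and>
     (p \<lless> (\<lambda>n. real n powr (- ((real k - 1) / real (card E)))) \<longrightarrow>
       (\<forall>\<^sub>F n in sequentially. \<forall>j\<ge>2.
          \<bar>cumulant (M n) j (\<lambda>\<omega>. subgraph_count k E n (A n \<omega>))\<bar>
          \<le> real j ^ (j - 1) * fact j ^ k
            * (fact k ^ (j - 1) / real (card (automorphisms {1..k} E)) ^ j)
            * real n ^ k * p n ^ card E))"
proof -
  define r where "r = (\<lambda>n. p n powr (real (card E) / (real k - 1)))"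
  define K where "K = (\<lambda>j. real j ^ (j - 1) * fact j ^ k
            * (fact k ^ (j - 1) / real (card (automorphisms {1..k} E)) ^ j))"
  have K_eq: "K j = real j ^ (j - 1) * fact j ^ k
            * (fact k ^ (j - 1) / real (card (automorphisms {1..k} E)) ^ j)" for j
    by (simp add: K_def)
  have "finite E"
    using assms(2) finite_subset[of E "Pow {1..k}"] by (auto simp: simple_graph_def)
  \<comment> \<open>Connectedness on at least two vertices forces an edge, so the threshold exponent
    does not divide by zero.\<close>
  then have e: "0 < card E"
    using connected_graph_edges_nonempty[OF assms(1,3)] by (simp add: card_gt_0_iff)
  have p: "0 < p n" if "1 \<le> n" for n
    using random_connection_model.p_range(1)[OF assms(5)[OF that]] .
  have r0: "0 < r n" if "1 \<le> n" for n using p[OF that] by (simp add: r_def)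
  \<comment> \<open>At the threshold \<open>r n\<close> would equal \<open>1 / n\<close>, so
    comparing \<open>p n\<close> with it decides whether \<open>q = n * r n\<close> is above or
    below 1. This does not involve \<open>j\<close>, hence one bound on \<open>n\<close> serves all
    \<open>j\<close>.\<close>
  have threshold: "(real n powr (- ((real k - 1) / real (card E)))) powr (real (card E) / (real k - 1)) = 1 / real n"
    if "1 \<le> n" for n
  proof -
    have "- ((real k - 1) / real (card E)) * (real (card E) / (real k - 1)) = - 1"
      using assms(1) e by (simp add: field_simps)
    then show ?thesis
      using that by (simp only: powr_powr) (simp add: powr_minus_divide)
  qed
  have rk: "r n ^ (k - 1) = p n ^ card E" if "1 \<le> n" for n
  proof -
    have "r n ^ (k - 1) = p n powr (real (card E) / (real k - 1) * real (k - 1))"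
      using p[OF that] by (simp add: r_def powr_powr flip: powr_realpow)
    also have "real (card E) / (real k - 1) * real (k - 1) = real (card E)"
      using assms(1) by (simp add: of_nat_diff)
    finally show ?thesis using p[OF that] by (simp add: powr_realpow)
  qed
  have bound: "\<bar>cumulant (M n) j (\<lambda>\<omega>. subgraph_count k E n (A n \<omega>))\<bar> \<le> K j * (real n * C)"
    if "1 \<le> n" "2 \<le> j" "\<And>v. k \<le> v \<Longrightarrow> v \<le> 1 + (k - 1) * j \<Longrightarrow> (real n * r n) ^ (v - 1) \<le> C" for n j C
    using random_connection_model.cumulant_subgraph_count_le[OF assms(5)[OF that(1)] assms(1,2,4) that(1,2)] that(3)
    unfolding K_def r_def by blast
  have dense: "\<forall>j\<ge>2. \<bar>cumulant (M n) j (\<lambda>\<omega>. subgraph_count k E n (A n \<omega>))\<bar>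
      \<le> K j * real n ^ (1 + (k - 1) * j) * p n ^ (j * card E)"
    if n: "1 \<le> n" and le: "real n powr (- ((real k - 1) / real (card E))) < p n" for n
  proof (intro allI impI)
    fix j :: nat assume j: "2 \<le> j"
    have "1 / real n \<le> r n"
      unfolding threshold[OF n, symmetric] r_def using le assms(1) by (intro powr_mono2) auto
    then have q: "1 \<le> real n * r n" using n by (simp add: field_simps)
    \<comment> \<open>For \<open>q \<ge> 1\<close> the largest power belongs to the largest
      \<open>v\<close>, namely \<open>1 + (k - 1) * j\<close>.\<close>
    have "\<bar>cumulant (M n) j (\<lambda>\<omega>. subgraph_count k E n (A n \<omega>))\<bar>
        \<le> K j * (real n * (real n * r n) ^ ((k - 1) * j))"
      using q by (intro bound[OF n j] power_increasing) auto
    also have "real n * (real n * r n) ^ ((k - 1) * j) = real n ^ (1 + (k - 1) * j) * p n ^ (j * card E)"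
    proof -
      have "r n ^ ((k - 1) * j) = p n ^ (card E * j)"
        by (simp only: power_mult rk[OF n])
      then show ?thesis
        by (simp only: power_mult_distrib power_add power_one_right mult.assoc mult.commute[of j])
    qed
    finally show "\<bar>cumulant (M n) j (\<lambda>\<omega>. subgraph_count k E n (A n \<omega>))\<bar>
        \<le> K j * real n ^ (1 + (k - 1) * j) * p n ^ (j * card E)"
      by (simp only: mult.assoc)
  qed
  have sparse: "\<forall>j\<ge>2. \<bar>cumulant (M n) j (\<lambda>\<omega>. subgraph_count k E n (A n \<omega>))\<bar>
      \<le> K j * real n ^ k * p n ^ card E"
    if n: "1 \<le> n" and le: "p n < real n powr (- ((real k - 1) / real (card E)))" for n
  proof (intro allI impI)
    fix j :: nat assume j: "2 \<le> j"
    have "r n \<le> 1 / real n"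
      unfolding threshold[OF n, symmetric] r_def using le assms(1) p[OF n] by (intro powr_mono2) auto
    then have q: "real n * r n \<le> 1" using n by (simp add: field_simps)
    \<comment> \<open>For \<open>q \<le> 1\<close> it belongs to the smallest,
      \<open>v = k\<close>.\<close>
    have "\<bar>cumulant (M n) j (\<lambda>\<omega>. subgraph_count k E n (A n \<omega>))\<bar>
        \<le> K j * (real n * (real n * r n) ^ (k - 1))"
      using q r0[OF n] by (intro bound[OF n j] power_decreasing) auto
    also have "real n * (real n * r n) ^ (k - 1) = real n ^ k * p n ^ card E"
    proof -
      have "real n * (real n * r n) ^ (k - 1) = real n ^ Suc (k - 1) * p n ^ card E"
        by (simp only: power_mult_distrib rk[OF n] power_Suc mult.assoc)
      then show ?thesis using assms(1) by simp
    qed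
    finally show "\<bar>cumulant (M n) j (\<lambda>\<omega>. subgraph_count k E n (A n \<omega>))\<bar>
        \<le> K j * real n ^ k * p n ^ card E"
      by (simp only: mult.assoc)
  qed
  show ?thesis
    unfolding K_eq[symmetric]
  proof (intro conjI impI)
    assume "(\<lambda>n. real n powr (- ((real k - 1) / real (card E)))) \<lless> p"
    from much_less_imp_eventually_less[OF this] show "\<forall>\<^sub>F n in sequentially. \<forall>j\<ge>2. \<bar>cumulant (M n) j (\<lambda>\<omega>. subgraph_count k E n (A n \<omega>))\<bar>
        \<le> K j * real n ^ (1 + (k - 1) * j) * p n ^ (j * card E)"
      using eventually_ge_at_top[of 1] by eventually_elim (rule dense)
  next
    assume "p \<lless> (\<lambda>n. real n powr (- ((real k - 1) / real (card E))))"
    from much_less_imp_eventually_less[OF this] show "\<forall>\<^sub>F n in sequentially. \<forall>j\<ge>2. \<bar>cumulant (M n) j (\<lambda>\<omega>. subgraph_count k E n (A n \<omega>))\<bar>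
        \<le> K j * real n ^ k * p n ^ card E"
      using eventually_ge_at_top[of 1] by eventually_elim (rule sparse)
  qed
qed

end
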